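(* For every tree $T$ with $\ell$ leaves, $$\vec{\mathcal{D}}(T) = \left(\tfrac{1}{2}+o(1)\right)\ell,$$ where $o(1)$ denotes a quantity depending only on $\ell$ that tends to $0$ as $\ell\to\infty$, uniformly over all trees with $\ell$ leaves.
   Context: A subtree $T'$ of a tree $T$ is a connected subset of its edges (trees identified with edge sets). For subtrees $T'\subseteq T$ and orientations $\sigma$ of the edges of $T$ and $\sigma'$ of the edges of $T'$, let $d_{T,T'}^{\sigma,\sigma'}\colon E(T')\to\{-1,1\}$ be $1$ on edges where $\sigma$ and $\sigma'$ agree and $-1$ otherwise. Let $\mathcal O(T)$ be the set of all pairs $(T',\sigma')$ where $T'$ is a subtree of $T$ rooted at some vertex $r$ of $T'$ and $\sigma'$ is the orientation of $T'$ with all edges directed away from $r$. The oriented discrepancy of $T$ is $$\vec{\mathcal{D}}(T)=\min_{\sigma\text{ orientation of }T}\ \max_{(T',\sigma')\in\mathcal O(T)}\ \Big|\sum_{e\in T'} d_{T,T'}^{\sigma,\sigma'}(e)\Big|.$$ *)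

theory Defs
  imports Complex_Main
begin

text \<open>Trees are identified with their edge sets; an edge is the two-element set of its ends, so the
  vertex set of \<open>T\<close> is \<open>\<Union>T\<close>. The empty edge set represents the tree with a single vertex.\<close>

definition is_path :: "'a set set \<Rightarrow> 'a list \<Rightarrow> bool" where
  "is_path T p \<longleftrightarrow> p \<noteq> [] \<and> distinct p \<and> successively (\<lambda>u v. {u, v} \<in> T) p"

definition edge_connected :: "'a set set \<Rightarrow> bool" where
  "edge_connected T \<longleftrightarrow> (\<forall>u\<in>\<Union>T. \<forall>v\<in>\<Union>T. \<exists>p. is_path T p \<and> hd p = u \<and> last p = v)"

definition is_cycle :: "'a set set \<Rightarrow> 'a list \<Rightarrow> bool" where
  "is_cycle T c \<longleftrightarrow> length c \<ge> 3 \<and> is_path T c \<and> {last c, hd c} \<in> T"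

definition is_tree :: "'a set set \<Rightarrow> bool" where
  "is_tree T \<longleftrightarrow> finite T \<and> (\<forall>e\<in>T. card e = 2) \<and> edge_connected T \<and> (\<nexists>c. is_cycle T c)"

definition leaves :: "'a set set \<Rightarrow> 'a set" where
  "leaves T = {v \<in> \<Union>T. card {e \<in> T. v \<in> e} = 1}"

definition subtree :: "'a set set \<Rightarrow> 'a set set \<Rightarrow> bool" where
  "subtree T' T \<longleftrightarrow> T' \<subseteq> T \<and> edge_connected T'"

text \<open>An orientation is a set of arcs \<open>(tail, head)\<close> containing exactly one arc for every edge.\<close>

definition is_orientation :: "('a \<times> 'a) set \<Rightarrow> 'a set set \<Rightarrow> bool" where
  "is_orientation \<sigma> T \<longleftrightarrow> bij_betw (\<lambda>(u, v). {u, v}) \<sigma> T"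

definition agreement :: "('a \<times> 'a) set \<Rightarrow> ('a \<times> 'a) set \<Rightarrow> 'a set \<Rightarrow> int" where
  "agreement \<sigma> \<sigma>' e = (if \<exists>(u, v)\<in>\<sigma> \<inter> \<sigma>'. {u, v} = e then 1 else -1)"

text \<open>The arc \<open>(u, v)\<close> is directed away from \<open>r\<close> if the path of \<open>T\<close> from \<open>r\<close> to \<open>v\<close> ends with the
  step from \<open>u\<close> to \<open>v\<close>.\<close>

definition directed_away :: "'a set set \<Rightarrow> 'a \<Rightarrow> 'a \<times> 'a \<Rightarrow> bool" where
  "directed_away T r = (\<lambda>(u, v). \<exists>p. is_path T (p @ [u, v]) \<and> hd (p @ [u]) = r)"

text \<open>The disjunct \<open>T' = {}\<close> admits the single-vertex subtree, whose root is not recoverable from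
  its edge set. It contributes the sum 0, so it affects the maximum of absolute values below only
  by making it well defined when \<open>T\<close> itself is the single-vertex tree.\<close>

definition rooted_subtrees :: "'a set set \<Rightarrow> ('a set set \<times> ('a \<times> 'a) set) set" where
  "rooted_subtrees T = {(T', \<sigma>'). subtree T' T \<and> is_orientation \<sigma>' T' \<and>
     (T' = {} \<or> (\<exists>r\<in>\<Union>T'. \<forall>a\<in>\<sigma>'. directed_away T' r a))}"

definition oriented_discrepancy :: "'a set set \<Rightarrow> int" where
  "oriented_discrepancy T =
     (MIN \<sigma>\<in>{\<sigma>. is_orientation \<sigma> T}. MAX (T', \<sigma>')\<in>rooted_subtrees T.
        \<bar>\<Sum>e\<in>T'. agreement \<sigma> \<sigma>' e\<bar>)"

text \<open>The minimum and the maximum range over finite nonempty sets.\<close>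

lemma orientation_subset:
  assumes "is_orientation \<sigma> T"
  shows "\<sigma> \<subseteq> \<Union>T \<times> \<Union>T"
proof
  fix a
  assume "a \<in> \<sigma>"
  obtain u v where a: "a = (u, v)"
    by (cases a)
  have "(\<lambda>(u, v). {u, v}) a \<in> T"
    using assms \<open>a \<in> \<sigma>\<close> unfolding is_orientation_def by (rule bij_betw_apply)
  then have "{u, v} \<in> T"
    by (simp add: a)
  then show "a \<in> \<Union>T \<times> \<Union>T"
    unfolding a by blast
qed

lemma finite_Union_tree:
  assumes "is_tree T"
  shows "finite (\<Union>T)"
proof (rule finite_Union)
  show "finite T"
    using assms by (simp add: is_tree_def)
  show "finite e" if "e \<in> T" for e
    using assms that by (intro card_ge_0_finite) (simp add: is_tree_def)
qed

lemma finite_orientations: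
  assumes "is_tree T"
  shows "finite {\<sigma>. is_orientation \<sigma> T}"
proof (rule finite_subset)
  show "{\<sigma>. is_orientation \<sigma> T} \<subseteq> Pow (\<Union>T \<times> \<Union>T)"
    by (intro subsetI PowI orientation_subset) (rule CollectD)
  show "finite (Pow (\<Union>T \<times> \<Union>T))"
    using finite_Union_tree[OF assms] by (intro finite_Pow_iff[THEN iffD2] finite_cartesian_product)
qed

lemma orientations_nonempty:
  assumes "is_tree T"
  shows "{\<sigma>. is_orientation \<sigma> T} \<noteq> {}"
proof -
  have "\<forall>e\<in>T. \<exists>a. (\<lambda>(u, v). {u, v}) a = e"
  proof
    fix e
    assume "e \<in> T"
    then obtain u v where "e = {u, v}"
      using assms by (auto simp: is_tree_def card_2_iff)
    then have "(\<lambda>(u, v). {u, v}) (u, v) = e"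
      by simp
    then show "\<exists>a. (\<lambda>(u, v). {u, v}) a = e"
      by (rule exI)
  qed
  then obtain f where f: "\<forall>e\<in>T. (\<lambda>(u, v). {u, v}) (f e) = e"
    by (rule bchoice[THEN exE])
  have "is_orientation (f ` T) T"
    unfolding is_orientation_def bij_betw_def
  proof
    show "inj_on (\<lambda>(u, v). {u, v}) (f ` T)"
      using f by (intro inj_onI) (elim imageE, simp)
    show "(\<lambda>(u, v). {u, v}) ` f ` T = T"
      unfolding image_image using f by simp
  qed
  then show ?thesis
    by blast
qed

lemma finite_rooted_subtrees:
  assumes "is_tree T"
  shows "finite (rooted_subtrees T)"
proof (rule finite_subset)
  show "rooted_subtrees T \<subseteq> Pow T \<times> Pow (\<Union>T \<times> \<Union>T)"
  proof (rule subsetI)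
    fix x
    assume "x \<in> rooted_subtrees T"
    then obtain T' \<sigma>' where x: "x = (T', \<sigma>')" and "T' \<subseteq> T" and o: "is_orientation \<sigma>' T'"
      by (auto simp: rooted_subtrees_def subtree_def)
    have "\<sigma>' \<subseteq> \<Union>T \<times> \<Union>T"
      using orientation_subset[OF o] Union_mono[OF \<open>T' \<subseteq> T\<close>]
      by (meson Sigma_mono order_trans)
    then show "x \<in> Pow T \<times> Pow (\<Union>T \<times> \<Union>T)"
      using x \<open>T' \<subseteq> T\<close> by simp
  qed
  show "finite (Pow T \<times> Pow (\<Union>T \<times> \<Union>T))"
    using assms finite_Union_tree[OF assms] by (simp add: is_tree_def)
qed

lemma rooted_subtrees_nonempty: "rooted_subtrees T \<noteq> {}"
proof -
  have "({}, {}) \<in> rooted_subtrees T"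
    by (simp add: rooted_subtrees_def subtree_def edge_connected_def is_orientation_def bij_betw_def)
  then show ?thesis
    by blast
qed

end

theory Submission
  imports Defs
begin

text \<open>Root \<open>T\<close> at a vertex \<open>r\<close> and let \<open>k\<close> be the number of leaves other than \<open>r\<close>. An orientation of
  \<open>T\<close> amounts to an antisymmetric sign on the arcs, and a rooted subtree contributes the sum of the
  signs of its arcs.

  Lower bound: by induction on the rooted tree, every signing admits two subtrees rooted at \<open>r\<close> (possibly
  empty) whose sums differ by at least \<open>k\<close>, so one of them has absolute value at least \<open>k / 2\<close>.

  Upper bound: follow a heavy-path decomposition and let the signs alternate along each heavy path.
  A subtree with root \<open>\<rho>\<close> uses the arcs on the way from \<open>\<rho>\<close> towards \<open>r\<close> backwards; there it meets only
  logarithmically many heavy paths and gains at most a constant on each of them. The sums of all the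
  other pieces are governed by the starting signs of the heavy paths. There is one such path for every
  leaf, and making half of the starting signs positive keeps all sums below \<open>k / 2 + O(log k)\<close>.\<close>

section \<open>Arborescences\<close>

abbreviation edges :: "('a \<times> 'a) set \<Rightarrow> 'a set set" where
  "edges D \<equiv> (\<lambda>(u, v). {u, v}) ` D"

abbreviation arc_sum :: "('a \<Rightarrow> 'a \<Rightarrow> int) \<Rightarrow> ('a \<times> 'a) set \<Rightarrow> int" where
  "arc_sum f A \<equiv> (\<Sum>(u, v)\<in>A. f u v)"

lemma mem_edges_iff: "{u, v} \<in> edges D \<longleftrightarrow> (u, v) \<in> D \<or> (v, u) \<in> D"
  by (force simp: image_iff doubleton_eq_iff)

lemma Union_edges: "\<Union>(edges D) = Field D"
  by (auto simp: Field_def)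

text \<open>The arcs are directed away from the root \<open>r\<close>, and \<open>k\<close> counts
  the sinks, that is, the leaves other than \<open>r\<close>. Both bounds induct on this
  construction from the root: \<open>extend\<close> puts a new arc on top, \<open>join\<close> glues
  two parts at a common root. The empty tree is excluded, so \<open>k\<close> is positive and the
  root has an outgoing arc.\<close>

inductive arborescence :: "('a \<times> 'a) set \<Rightarrow> 'a \<Rightarrow> nat \<Rightarrow> bool" where
  edge: "r \<noteq> c \<Longrightarrow> arborescence {(r, c)} r 1"
| extend: "arborescence D c k \<Longrightarrow> r \<notin> Field D \<Longrightarrow> arborescence (insert (r, c) D) r k"
| join: "arborescence D1 r k1 \<Longrightarrow> arborescence D2 r k2 \<Longrightarrow> Field D1 \<inter> Field D2 = {r} \<Longrightarrow>
    arborescence (D1 \<union> D2) r (k1 + k2)"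

text \<open>A non-inductive description without a leaf count, easily checked after arcs have been
  removed; it holds for the empty set with any root. The last conjunct excludes loops and edges used
  in both directions.\<close>

definition out_tree :: "('a \<times> 'a) set \<Rightarrow> 'a \<Rightarrow> bool" where
  "out_tree A r \<longleftrightarrow> (\<forall>u v. (u, v) \<in> A \<longrightarrow> (r, u) \<in> A\<^sup>*) \<and>
     (\<forall>u v w. (u, v) \<in> A \<longrightarrow> (w, v) \<in> A \<longrightarrow> u = w) \<and> r \<notin> Range A \<and>
     (\<forall>u v. (u, v) \<in> A \<longrightarrow> (v, u) \<notin> A)"

lemma out_treeI:
  assumes "\<And>u v. (u, v) \<in> A \<Longrightarrow> (r, u) \<in> A\<^sup>*"
    and "\<And>u v w. (u, v) \<in> A \<Longrightarrow> (w, v) \<in> A \<Longrightarrow> u = w"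
    and "\<And>u. (u, r) \<notin> A"
    and "\<And>u v. (u, v) \<in> A \<Longrightarrow> (v, u) \<notin> A"
  shows "out_tree A r"
  using assms unfolding out_tree_def by blast

lemma out_treeD:
  assumes "out_tree A r"
  shows out_tree_reach: "(u, v) \<in> A \<Longrightarrow> (r, u) \<in> A\<^sup>*"
    and out_tree_unique: "(u, v) \<in> A \<Longrightarrow> (w, v) \<in> A \<Longrightarrow> u = w"
    and out_tree_root: "(u, r) \<notin> A"
    and out_tree_asym: "(u, v) \<in> A \<Longrightarrow> (v, u) \<notin> A"
  using assms unfolding out_tree_def by blast+

lemma arborescence_root: "arborescence D r k \<Longrightarrow> r \<in> Domain D"
  by (induction rule: arborescence.induct) auto

lemma arborescence_pos: "arborescence D r k \<Longrightarrow> k > 0"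
  by (induction rule: arborescence.induct) auto

lemma arborescence_finite: "arborescence D r k \<Longrightarrow> finite D"
  by (induction rule: arborescence.induct) auto

lemma arborescence_out_tree: "arborescence D r k \<Longrightarrow> out_tree D r"
proof (induction rule: arborescence.induct)
  case (edge r c)
  then show ?case
    by (auto simp: out_tree_def)
next
  case (extend D c k r)
  have "c \<noteq> r"
    using arborescence_root[OF extend.hyps(1)] extend.hyps(2) by (auto simp: Field_def)
  note IH = out_treeD[OF extend.IH]
  have r: "(r, x) \<notin> D" "(x, r) \<notin> D" for x
    using extend.hyps(2) by (auto simp: Field_def)
  have mono: "(c, u) \<in> D\<^sup>* \<Longrightarrow> (r, u) \<in> (insert (r, c) D)\<^sup>*" for u
    by (meson converse_rtrancl_into_rtrancl insertI1 in_mono rtrancl_mono subset_insertI)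
  show ?case
  proof (rule out_treeI)
    show "(r, u) \<in> (insert (r, c) D)\<^sup>*" if "(u, v) \<in> insert (r, c) D" for u v
      using that IH(1) mono by blast
    show "u = w" if "(u, v) \<in> insert (r, c) D" "(w, v) \<in> insert (r, c) D" for u v w
      using that IH(2,3) by auto
    show "(u, r) \<notin> insert (r, c) D" for u
      using r \<open>c \<noteq> r\<close> by auto
    show "(v, u) \<notin> insert (r, c) D" if "(u, v) \<in> insert (r, c) D" for u v
      using that r IH(4) \<open>c \<noteq> r\<close> by auto
  qed
next
  case (join D1 r k1 D2 k2)
  note IH1 = out_treeD[OF join.IH(1)] and IH2 = out_treeD[OF join.IH(2)]
  have meet: "x = r" if "x \<in> Field D1" "x \<in> Field D2" for x
    using that join.hyps(3) by blast
  have meet2: "(u, v) \<in> D1 \<Longrightarrow> (w, v) \<in> D2 \<Longrightarrow> False" for u v w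
    using meet[of v] IH1(3) IH2(3) by (auto simp: Field_def)
  have meet3: "(u, v) \<in> D1 \<Longrightarrow> (v, u) \<in> D2 \<Longrightarrow> False" for u v
    using meet[of u] meet[of v] IH1(3) by (auto simp: Field_def)
  show ?case
  proof (rule out_treeI)
    show "(r, u) \<in> (D1 \<union> D2)\<^sup>*" if "(u, v) \<in> D1 \<union> D2" for u v
      using that IH1(1) IH2(1) by (meson Un_iff in_rtrancl_UnI)
    show "u = w" if "(u, v) \<in> D1 \<union> D2" "(w, v) \<in> D1 \<union> D2" for u v w
      using that IH1(2) IH2(2) meet2 by blast
    show "(u, r) \<notin> D1 \<union> D2" for u
      using IH1(3) IH2(3) by auto
    show "(v, u) \<notin> D1 \<union> D2" if "(u, v) \<in> D1 \<union> D2" for u v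
      using that IH1(4) IH2(4) meet3 by blast
  qed
qed

text \<open>Serves the maximality argument in \<open>tree_arborescence\<close>. The new count
  depends on whether \<open>v\<close> was a sink and is left open. At the root of an
  \<open>extend\<close>, the new arc becomes a branch of a \<open>join\<close>.\<close>

lemma arborescence_add_leaf:
  assumes "arborescence D r k" "v \<in> Field D" "w \<notin> Field D"
  shows "\<exists>k'. arborescence (insert (v, w) D) r k'"
  using assms
proof (induction arbitrary: v w rule: arborescence.induct)
  case (edge r c)
  have "w \<noteq> r" "w \<noteq> c" "v = r \<or> v = c"
    using edge.prems by (auto simp: Field_def)
  show ?case
  proof (cases "v = r")
    case True
    have "arborescence ({(r, w)} \<union> {(r, c)}) r (1 + 1)"
      using \<open>w \<noteq> r\<close> \<open>w \<noteq> c\<close> edge.hyps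
      by (intro arborescence.join arborescence.edge) (auto simp: Field_def)
    then show ?thesis
      using True by (auto simp: insert_commute)
  next
    case False
    then have "v = c"
      using \<open>v = r \<or> v = c\<close> by blast
    have "arborescence (insert (r, c) {(c, w)}) r 1"
      using \<open>w \<noteq> r\<close> \<open>w \<noteq> c\<close> edge.hyps
      by (intro arborescence.extend arborescence.edge) (auto simp: Field_def)
    then show ?thesis
      using \<open>v = c\<close> by (auto simp: insert_commute)
  qed
next
  case (extend D c k r)
  have w: "w \<noteq> r" "w \<noteq> c" "w \<notin> Field D"
    using extend.prems by (auto simp: Field_def)
  show ?case
  proof (cases "v = r")
    case True
    have "arborescence ({(r, w)} \<union> insert (r, c) D) r (1 + k)"
      using w extend.hyps
      by (intro arborescence.join arborescence.edge arborescence.extend) (auto simp: Field_def)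
    then show ?thesis
      using True by (auto simp: insert_commute)
  next
    case False
    then have "v \<in> Field D"
      using extend.prems arborescence_root[OF extend.hyps(1)] by (auto simp: Field_def)
    then obtain k' where "arborescence (insert (v, w) D) c k'"
      using extend.IH w by blast
    then have "arborescence (insert (r, c) (insert (v, w) D)) r k'"
      using extend.hyps(2) False w by (intro arborescence.extend) auto
    then show ?thesis
      by (auto simp: insert_commute)
  qed
next
  case (join D1 r k1 D2 k2)
  have w: "w \<notin> Field D1" "w \<notin> Field D2"
    using join.prems by auto
  show ?case
  proof (cases "v \<in> Field D1")
    case True
    then obtain k' where "arborescence (insert (v, w) D1) r k'"
      using join.IH(1) w by blast
    then have "arborescence (insert (v, w) D1 \<union> D2) r (k' + k2)"
      using join.hyps w True by (intro arborescence.join) auto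
    then show ?thesis
      by auto
  next
    case False
    then have "v \<in> Field D2"
      using join.prems by auto
    then obtain k' where "arborescence (insert (v, w) D2) r k'"
      using join.IH(2) w by blast
    then have "arborescence (D1 \<union> insert (v, w) D2) r (k1 + k')"
      using join.hyps w \<open>v \<in> Field D2\<close> by (intro arborescence.join) auto
    then show ?thesis
      by auto
  qed
qed

section \<open>Leaves as sinks\<close>

lemma card_sinks:
  assumes "arborescence D r k"
  shows "card (Range D - Domain D) = k"
  using assms
proof (induction rule: arborescence.induct)
  case (edge r c)
  then show ?case
    by auto
next
  case (extend D c k r)
  have "Range (insert (r, c) D) - Domain (insert (r, c) D) = Range D - Domain D"
    using arborescence_root[OF extend.hyps(1)] extend.hyps(2) by (auto simp: Field_def)
  then show ?case
    using extend.IH by simp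
next
  case (join D1 r k1 D2 k2)
  have r: "r \<in> Domain D1" "r \<in> Domain D2"
    using arborescence_root[OF join.hyps(1)] arborescence_root[OF join.hyps(2)] .
  have meet: "x = r" if "x \<in> Domain D1 \<or> x \<in> Range D1" "x \<in> Domain D2 \<or> x \<in> Range D2" for x
    using that join.hyps(3) unfolding Field_def by blast
  \<comment> \<open>The common root is the only shared vertex and a tail on both sides, so no sink
    is shared and every sink remains one.\<close>
  have "(Range D1 - Domain D1) \<inter> (Range D2 - Domain D2) = {}"
    using meet r by (metis DiffE disjoint_iff)
  moreover have "Range (D1 \<union> D2) - Domain (D1 \<union> D2) =
      (Range D1 - Domain D1) \<union> (Range D2 - Domain D2)"
    unfolding Range_Un_eq Domain_Un_eq using meet r
    by (intro set_eqI) (metis DiffD1 DiffD2 DiffI Un_iff)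
  moreover have "finite (Range D1)" "finite (Range D2)"
    using arborescence_finite[OF join.hyps(1)] arborescence_finite[OF join.hyps(2)]
    by (simp_all add: finite_Range)
  ultimately show ?case
    using join.IH by (simp add: card_Un_disjoint)
qed

text \<open>A vertex of \<open>D\<close> other than \<open>r\<close> has exactly one incoming arc,
  so its incident edges are that one and one for each outgoing arc; degree one then means no
  outgoing arc. The root is set aside because it can be a leaf without being a sink.\<close>

lemma leaves_eq_sinks:
  assumes "out_tree D r"
  shows "leaves (edges D) - {r} = Range D - Domain D"
proof -
  note D = out_treeD[OF assms]
  have "v \<in> leaves (edges D) \<longleftrightarrow> v \<in> Range D - Domain D" if "v \<noteq> r" for v
  proof (cases "v \<in> Field D")
    case False
    then have "v \<notin> \<Union>(edges D)" by (simp add: Union_edges)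
    then show ?thesis
      using False unfolding leaves_def Field_def by blast
  next
    case True
    have "v \<in> Range D"
    proof (rule ccontr)
      assume "v \<notin> Range D"
      then obtain w where "(v, w) \<in> D"
        using True by (auto simp: Field_def)
      then have "(r, v) \<in> D\<^sup>*"
        using D(1) by blast
      then show False
        using \<open>v \<noteq> r\<close> \<open>v \<notin> Range D\<close> by (auto elim: rtranclE)
    qed
    then obtain u where u: "(u, v) \<in> D" by blast
    have inc: "{e \<in> edges D. v \<in> e} = insert {u, v} ((\<lambda>w. {v, w}) ` {w. (v, w) \<in> D})"
    proof (intro equalityI subsetI)
      fix e
      assume "e \<in> {e \<in> edges D. v \<in> e}"
      then obtain a b where ab: "(a, b) \<in> D" "e = {a, b}" "v = a \<or> v = b"
        by auto
      then show "e \<in> insert {u, v} ((\<lambda>w. {v, w}) ` {w. (v, w) \<in> D})"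
        using D(2)[OF u] by blast
    next
      fix e
      assume "e \<in> insert {u, v} ((\<lambda>w. {v, w}) ` {w. (v, w) \<in> D})"
      then obtain a b where "(a, b) \<in> D" "e = {a, b}" "v \<in> e"
        using u by blast
      then show "e \<in> {e \<in> edges D. v \<in> e}"
        by blast
    qed
    have "card {e \<in> edges D. v \<in> e} = 1 \<longleftrightarrow> v \<notin> Domain D"
    proof
      assume "card {e \<in> edges D. v \<in> e} = 1"
      then obtain x where x: "{e \<in> edges D. v \<in> e} = {x}"
        using card_1_singletonE by blast
      show "v \<notin> Domain D"
      proof
        assume "v \<in> Domain D"
        then obtain w where w: "(v, w) \<in> D" by blast
        then have "{u, v} = {v, w}"
          using x unfolding inc by blast
        then have "u = w"
          by (auto simp: doubleton_eq_iff)
        then show False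
          using u w D(4) by blast
      qed
    next
      assume "v \<notin> Domain D"
      then have "{e \<in> edges D. v \<in> e} = {{u, v}}"
        unfolding inc by blast
      then show "card {e \<in> edges D. v \<in> e} = 1"
        by simp
    qed
    then show ?thesis
      using True \<open>v \<in> Range D\<close> by (auto simp: leaves_def Union_edges)
  qed
  moreover have "r \<notin> Range D"
    using D(3) by blast
  ultimately show ?thesis
    by (intro set_eqI) (metis Diff_iff singletonD singletonI)
qed

text \<open>The off-by-one accounts for the root, which may itself be a leaf.\<close>

lemma leaves_bounds:
  assumes "arborescence D r k"
  shows "k \<le> card (leaves (edges D))" "card (leaves (edges D)) \<le> k + 1"
proof -
  have k: "card (leaves (edges D) - {r}) = k"
    using leaves_eq_sinks[OF arborescence_out_tree[OF assms]] card_sinks[OF assms] by simp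
  have fin: "finite (leaves (edges D))"
    using arborescence_finite[OF assms] finite_subset[of "leaves (edges D)" "Field D"]
    by (auto simp: leaves_def Union_edges finite_Field)
  show "k \<le> card (leaves (edges D))"
    using k card_mono[OF fin, of "leaves (edges D) - {r}"] by auto
  show "card (leaves (edges D)) \<le> k + 1"
    using k by (cases "r \<in> leaves (edges D)") (simp_all add: card_Diff_singleton)
qed

section \<open>Rooted subtrees of a tree\<close>

lemma is_path_Cons:
  "is_path T (x # p) \<longleftrightarrow> p = [] \<or> (is_path T p \<and> x \<notin> set p \<and> {x, hd p} \<in> T)"
  by (cases p) (auto simp: is_path_def)

lemma is_path_mono: "is_path S p \<Longrightarrow> S \<subseteq> T \<Longrightarrow> is_path T p"
  unfolding is_path_def by (auto elim!: successively_mono)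

lemma is_path_imp_rtrancl:
  "is_path T p \<Longrightarrow> (hd p, last p) \<in> {(u, v). {u, v} \<in> T}\<^sup>*"
proof (induction p)
  case Nil
  then show ?case by (simp add: is_path_def)
next
  case (Cons x p)
  then show ?case
    by (auto simp: is_path_Cons intro: converse_rtrancl_into_rtrancl)
qed

lemma is_path_suffix:
  assumes "is_path T (p @ q)" "q \<noteq> []"
  shows "is_path T q"
  using assms by (auto simp: is_path_def successively_append_iff)

text \<open>The path is built from its end. If the next vertex already lies on it, the part before
  that vertex is dropped, so the path stays simple.\<close>

lemma rtrancl_imp_is_path:
  assumes "(u, v) \<in> {(u, v). {u, v} \<in> T}\<^sup>*"
  shows "\<exists>p. is_path T p \<and> hd p = u \<and> last p = v"
  using assms
proof (induction rule: converse_rtrancl_induct)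
  case base
  have "is_path T [v]" by (simp add: is_path_def)
  then show ?case by fastforce
next
  case (step x y)
  then obtain p where p: "is_path T p" "hd p = y" "last p = v" by blast
  show ?case
  proof (cases "x \<in> set p")
    case True
    then obtain a b where "p = a @ x # b"
      by (meson split_list)
    then show ?thesis
      using p is_path_suffix[of T a "x # b"] by (intro exI[of _ "x # b"]) auto
  next
    case False
    moreover have "p \<noteq> []"
      using p(1) by (simp add: is_path_def)
    ultimately show ?thesis
      using p step.hyps by (intro exI[of _ "x # p"]) (auto simp: is_path_Cons)
  qed
qed

lemma edge_connected_iff:
  "edge_connected T \<longleftrightarrow> (\<forall>u\<in>\<Union>T. \<forall>v\<in>\<Union>T. (u, v) \<in> {(u, v). {u, v} \<in> T}\<^sup>*)"
proof -
  have "(\<exists>p. is_path T p \<and> hd p = u \<and> last p = v) \<longleftrightarrow> (u, v) \<in> {(u, v). {u, v} \<in> T}\<^sup>*" for u v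
    by (rule iffI, elim exE conjE, drule is_path_imp_rtrancl, simp) (rule rtrancl_imp_is_path)
  then show ?thesis
    by (simp only: edge_connected_def)
qed

lemma edge_connected_edges:
  assumes "out_tree D r"
  shows "edge_connected (edges D)"
proof -
  let ?R = "{(u, v). {u, v} \<in> edges D}"
  have R: "?R = D \<union> D\<inverse>"
    by (auto simp: mem_edges_iff)
  have reach: "(r, u) \<in> ?R\<^sup>*" if u: "u \<in> Field D" for u
  proof -
    have "(r, u) \<in> D\<^sup>*"
      using u out_tree_reach[OF assms] unfolding Field_def by (blast intro: rtrancl_into_rtrancl)
    then show ?thesis
      unfolding R by (rule in_rtrancl_UnI[OF disjI1])
  qed
  have "sym ?R"
    by (auto simp: sym_def insert_commute)
  then have "sym (?R\<^sup>*)"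
    by (rule sym_rtrancl)
  then show ?thesis
    unfolding edge_connected_iff Union_edges
    by (intro ballI) (rule rtrancl_trans[OF symD[OF _ reach] reach])
qed

text \<open>The first step cannot go backwards, since no arc enters the root. After the arc
  \<open>(x, u)\<close>, a backward step from \<open>u\<close> could only lead to \<open>x\<close>,
  the unique tail of an arc into \<open>u\<close>, and a simple path does not return there.\<close>

lemma path_from_root_follows_arcs:
  assumes "out_tree D r" "is_path (edges D) (p @ [u, v])" "hd (p @ [u]) = r"
  shows "(u, v) \<in> D"
  using assms(2,3)
proof (induction p arbitrary: u v rule: rev_induct)
  case Nil
  then have "{u, v} \<in> edges D" "u = r"
    by (simp_all add: is_path_def)
  then show ?case
    using out_tree_root[OF assms(1)] unfolding mem_edges_iff by blast
next
  case (snoc x p)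
  have "is_path (edges D) (p @ [x, u, v])"
    using snoc.prems(1) by simp
  then have dist: "x \<noteq> v" and uv: "{u, v} \<in> edges D"
    and path: "is_path (edges D) (p @ [x, u])"
    by (simp_all add: is_path_def successively_append_iff)
  have "hd (p @ [x]) = r"
    using snoc.prems(2) by (cases p) auto
  then have "(x, u) \<in> D"
    using snoc.IH path by blast
  then show ?case
    using uv dist out_tree_unique[OF assms(1)] unfolding mem_edges_iff by blast
qed

lemma is_path_vertices:
  "is_path T p \<Longrightarrow> length p \<ge> 2 \<Longrightarrow> set p \<subseteq> \<Union>T"
proof (induction p)
  case (Cons x p)
  then have p: "is_path T p" "{x, hd p} \<in> T" "p \<noteq> []"
    by (auto simp: is_path_Cons)
  then show ?case
    using Cons.IH by (cases p; cases "tl p") auto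
qed simp

lemma arborescence_directed_away:
  assumes "arborescence D r k" "(u, v) \<in> D"
  shows "directed_away (edges D) r (u, v)"
  using assms
proof (induction arbitrary: u v rule: arborescence.induct)
  case (edge r c)
  then show ?case
    by (auto simp: directed_away_def is_path_def intro!: exI[of _ "[]"])
next
  case (extend D c k r)
  have "c \<noteq> r"
    using arborescence_root[OF extend.hyps(1)] extend.hyps(2) by (auto simp: Field_def)
  show ?case
  proof (cases "(u, v) \<in> D")
    case False
    then show ?thesis
      using extend.prems \<open>c \<noteq> r\<close>
      by (auto simp: directed_away_def is_path_def intro!: exI[of _ "[]"])
  next
    case True
    then obtain p where p: "is_path (edges D) (p @ [u, v])" "hd (p @ [u]) = c"
      using extend.IH by (auto simp: directed_away_def)
    have "set (p @ [u, v]) \<subseteq> Field D"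
      using is_path_vertices[OF p(1)] by (simp add: Union_edges)
    then have "r \<notin> set (p @ [u, v])"
      using extend.hyps(2) by blast
    moreover have "hd (p @ [u, v]) = c"
      using p(2) by (cases p) auto
    ultimately have "is_path (edges (insert (r, c) D)) (r # p @ [u, v])"
      using is_path_mono[OF p(1), of "edges (insert (r, c) D)"] by (auto simp: is_path_Cons)
    then show ?thesis
      unfolding directed_away_def by (auto intro!: exI[of _ "r # p"])
  qed
next
  case (join D1 r k1 D2 k2)
  have mono: "directed_away (edges D') r (u, v)"
    if away: "directed_away (edges D) r (u, v)" and "D \<subseteq> D'" for D D' :: "('a \<times> 'a) set"
  proof -
    obtain p where p: "is_path (edges D) (p @ [u, v])" "hd (p @ [u]) = r"
      using away by (auto simp: directed_away_def)
    have "is_path (edges D') (p @ [u, v])"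
      using p(1) image_mono[OF \<open>D \<subseteq> D'\<close>] by (rule is_path_mono)
    then show ?thesis
      using p(2) by (auto simp: directed_away_def)
  qed
  show ?case
    using join.prems join.IH mono[of D1 "D1 \<union> D2"] mono[of D2 "D1 \<union> D2"] by blast
qed

section \<open>From trees and rooted subtrees to arborescences and back\<close>

lemma is_orientation_edges:
  assumes "\<And>u v. (u, v) \<in> D \<Longrightarrow> (v, u) \<notin> D"
  shows "is_orientation D (edges D)"
  unfolding is_orientation_def
  by (rule inj_on_imp_bij_betw) (use assms in \<open>force simp: inj_on_def doubleton_eq_iff\<close>)

text \<open>Take a maximal arborescence with root \<open>r\<close> inside \<open>T\<close>. By
  \<open>arborescence_add_leaf\<close> its vertex set is closed under neighbours in
  \<open>T\<close>, hence contains all vertices by connectivity. An edge left over would close a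
  cycle with the path in \<open>edges D\<close> between its ends.\<close>

lemma tree_arborescence:
  assumes "is_tree T" "r \<in> \<Union>T"
  obtains D k where "arborescence D r k" "edges D = T"
proof -
  let ?F = "{D. (\<exists>k. arborescence D r k) \<and> edges D \<subseteq> T}"
  have "?F \<subseteq> Pow (\<Union>T \<times> \<Union>T)"
    by (auto 0 4)
  then have "finite ?F"
    using finite_Union_tree[OF assms(1)] by (meson finite_Pow_iff finite_SigmaI finite_subset)
  moreover have "?F \<noteq> {}"
  proof -
    obtain e where "e \<in> T" "r \<in> e" "card e = 2"
      using assms by (auto simp: is_tree_def)
    then obtain c where "e = {r, c}" "r \<noteq> c"
      by (auto simp: card_2_iff)
    then have "{(r, c)} \<in> ?F"
      using \<open>e \<in> T\<close> by (auto intro: arborescence.edge)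
    then show ?thesis
      by blast
  qed
  ultimately obtain D where "D \<in> ?F" and max: "\<And>D'. D' \<in> ?F \<Longrightarrow> D \<subseteq> D' \<Longrightarrow> D = D'"
    using finite_has_maximal[of ?F] by (metis (no_types, lifting))
  then obtain k where D: "arborescence D r k" "edges D \<subseteq> T"
    by blast
  have "r \<in> Field D"
    using arborescence_root[OF D(1)] by (auto simp: Field_def)
  have closed: "w \<in> Field D" if "v \<in> Field D" "{v, w} \<in> T" for v w
  proof (rule ccontr)
    assume w: "w \<notin> Field D"
    then have "insert (v, w) D \<in> ?F"
      using arborescence_add_leaf[OF D(1) that(1)] D(2) that(2) by auto
    then have "(v, w) \<in> D"
      using max by blast
    then show False
      using w by (auto simp: Field_def)
  qed
  have field: "v \<in> Field D" if "v \<in> \<Union>T" for v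
  proof -
    have "(r, v) \<in> {(u, v). {u, v} \<in> T}\<^sup>*"
      using assms that unfolding is_tree_def edge_connected_iff by blast
    then show ?thesis
      by (induction rule: rtrancl_induct) (use \<open>r \<in> Field D\<close> closed in auto)
  qed
  have "T \<subseteq> edges D"
  proof
    fix e
    assume "e \<in> T"
    then have "card e = 2"
      using assms(1) by (simp add: is_tree_def)
    then obtain v w where e: "e = {v, w}" "v \<noteq> w"
      by (auto simp: card_2_iff)
    then have "v \<in> Field D" "w \<in> Field D"
      using field \<open>e \<in> T\<close> by blast+
    then obtain p where p: "is_path (edges D) p" "hd p = v" "last p = w"
      using edge_connected_edges[OF arborescence_out_tree[OF D(1)]]
      unfolding edge_connected_def Union_edges by blast
    show "e \<in> edges D"
    proof (rule ccontr)
      assume no: "e \<notin> edges D"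
      \<comment> \<open>A path with one vertex would give \<open>v = w\<close>, and one with two
        vertices would put \<open>e\<close> into \<open>edges D\<close>.\<close>
      have "length p \<ge> 3"
      proof (rule ccontr)
        assume "\<not> length p \<ge> 3"
        moreover have "p \<noteq> []"
          using p(1) by (simp add: is_path_def)
        ultimately obtain x y where "p = [x] \<or> p = [x, y]"
          by (cases p; cases "tl p"; cases "tl (tl p)") auto
        then show False
          using p e no by (auto simp: is_path_def)
      qed
      moreover have "is_path T p"
        using p(1) D(2) by (rule is_path_mono)
      moreover have "{last p, hd p} \<in> T"
        using p e \<open>e \<in> T\<close> by (simp add: insert_commute)
      ultimately have "is_cycle T p"
        by (simp add: is_cycle_def)
      then show False
        using assms(1) by (auto simp: is_tree_def)
    qed
  qed
  then show ?thesis
    using that D by blast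
qed

text \<open>The set \<open>T'\<close> is itself a tree, so it has an arborescence \<open>D\<close>
  from the same root. Arcs directed away from the root lie in \<open>D\<close> by
  \<open>path_from_root_follows_arcs\<close>. Both sets contain exactly one arc for every edge, so
  they coincide.\<close>

lemma rooted_subtree_arborescence:
  assumes "is_tree T" "(T', \<sigma>') \<in> rooted_subtrees T" "T' \<noteq> {}"
  obtains r k where "arborescence \<sigma>' r k" "edges \<sigma>' = T'"
proof -
  obtain r where r: "T' \<subseteq> T" "edge_connected T'" "is_orientation \<sigma>' T'" "r \<in> \<Union>T'"
    and away: "\<And>a. a \<in> \<sigma>' \<Longrightarrow> directed_away T' r a"
    using assms(2,3) by (auto simp: rooted_subtrees_def subtree_def)
  have "is_cycle T c" if "is_cycle T' c" for c
    using that r(1) is_path_mono[OF _ r(1)] by (auto simp: is_cycle_def)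
  then have "is_tree T'"
    using assms(1) r(1,2) finite_subset[OF r(1)] by (auto simp: is_tree_def)
  then obtain D k where D: "arborescence D r k" "edges D = T'"
    using r(4) by (rule tree_arborescence)
  note out = arborescence_out_tree[OF D(1)]
  have "\<sigma>' \<subseteq> D"
  proof
    fix a
    assume "a \<in> \<sigma>'"
    obtain u v where a: "a = (u, v)"
      by (cases a)
    show "a \<in> D"
      using away[OF \<open>a \<in> \<sigma>'\<close>] path_from_root_follows_arcs[OF out]
      unfolding a D(2) directed_away_def by blast
  qed
  have sigma: "edges \<sigma>' = T'"
    using r(3) by (simp add: is_orientation_def bij_betw_def)
  have "D \<subseteq> \<sigma>'"
  proof (rule subrelI)
    fix u v
    assume uv: "(u, v) \<in> D"
    then have "{u, v} \<in> edges \<sigma>'"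
      unfolding sigma D(2)[symmetric] by (simp add: mem_edges_iff)
    then have "(u, v) \<in> \<sigma>' \<or> (v, u) \<in> \<sigma>'"
      by (simp add: mem_edges_iff)
    then show "(u, v) \<in> \<sigma>'"
      using \<open>\<sigma>' \<subseteq> D\<close> out_tree_asym[OF out uv] by blast
  qed
  then have "\<sigma>' = D"
    using \<open>\<sigma>' \<subseteq> D\<close> by (rule equalityI[rotated])
  then show ?thesis
    using that D by simp
qed

lemma arborescence_rooted_subtree:
  assumes "arborescence A r k" "edges A \<subseteq> T"
  shows "(edges A, A) \<in> rooted_subtrees T"
proof -
  have out: "out_tree A r"
    using assms(1) by (rule arborescence_out_tree)
  have "r \<in> \<Union>(edges A)"
    using arborescence_root[OF assms(1)] by (auto simp: Union_edges Field_def)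
  moreover have "\<forall>a\<in>A. directed_away (edges A) r a"
    using arborescence_directed_away[OF assms(1)] by auto
  ultimately show ?thesis
    using assms(2) edge_connected_edges[OF out] is_orientation_edges[OF out_tree_asym[OF out]]
    by (simp only: rooted_subtrees_def subtree_def mem_Collect_eq prod.case) blast
qed

text \<open>Turns a discrepancy sum into a sum of signs of arcs. By the hypothesis every edge stems
  from a single arc, so the sum over edges can be reindexed.\<close>

lemma sum_agreement:
  assumes "\<And>u v. (u, v) \<in> A \<Longrightarrow> (v, u) \<notin> A"
  shows "(\<Sum>e\<in>edges A. agreement \<sigma> A e) = arc_sum (\<lambda>u v. if (u, v) \<in> \<sigma> then 1 else -1) A"
proof -
  have inj: "inj_on (\<lambda>(u, v). {u, v}) A"
    using is_orientation_edges[OF assms] by (simp add: is_orientation_def bij_betw_def)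
  have "agreement \<sigma> A {u, v} = (if (u, v) \<in> \<sigma> then 1 else -1)" if "(u, v) \<in> A" for u v
  proof -
    have "(\<exists>(x, y)\<in>\<sigma> \<inter> A. {x, y} = {u, v}) \<longleftrightarrow> (u, v) \<in> \<sigma>"
      using that assms[OF that] by (fastforce simp: doubleton_eq_iff)
    then show ?thesis
      by (simp only: agreement_def)
  qed
  then show ?thesis
    unfolding sum.reindex[OF inj] comp_def by (intro sum.cong) auto
qed

lemma arc_sum_insert:
  "finite A \<Longrightarrow> (u, v) \<notin> A \<Longrightarrow> arc_sum f (insert (u, v) A) = f u v + arc_sum f A"
  by simp

section \<open>Lower bound\<close>

text \<open>A single arc against the empty subtree gives a difference of 1, an arc put on top need
  not lower the difference, and at a \<open>join\<close> the differences add up. The empty set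
  stands for the subtree consisting of \<open>r\<close> alone.\<close>

lemma lower_bound_subtrees:
  assumes "arborescence D r k" and "\<And>u v. (u, v) \<in> D \<Longrightarrow> \<bar>f u v\<bar> = 1"
  shows "\<exists>A B. A \<subseteq> D \<and> (A = {} \<or> (\<exists>j. arborescence A r j)) \<and>
    B \<subseteq> D \<and> (B = {} \<or> (\<exists>j. arborescence B r j)) \<and> int k \<le> arc_sum f A - arc_sum f B"
  using assms
proof (induction rule: arborescence.induct)
  case (edge r c)
  have tree: "arborescence {(r, c)} r 1"
    using edge.hyps by (rule arborescence.edge)
  have "f r c = 1 \<or> f r c = -1"
    using edge.prems[of r c] by auto
  then show ?case
  proof
    assume "f r c = 1"
    then show ?thesis
      using tree by (intro exI[of _ "{(r, c)}"] exI[of _ "{}"]) auto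
  next
    assume "f r c = -1"
    then show ?thesis
      using tree by (intro exI[of _ "{}"] exI[of _ "{(r, c)}"]) auto
  qed
next
  case (extend D c k r)
  let ?D = "insert (r, c) D"
  obtain A B where A: "A \<subseteq> D" "A = {} \<or> (\<exists>j. arborescence A c j)"
    and B: "B \<subseteq> D" "B = {} \<or> (\<exists>j. arborescence B c j)"
    and AB: "int k \<le> arc_sum f A - arc_sum f B"
    using extend.IH extend.prems by auto
  have "r \<noteq> c"
    using arborescence_root[OF extend.hyps(1)] extend.hyps(2) by (auto simp: Field_def)
  have fin: "finite D"
    using extend.hyps(1) by (rule arborescence_finite)
  have sub: "insert (r, c) C \<subseteq> ?D" "\<exists>j. arborescence (insert (r, c) C) r j"
    "arc_sum f (insert (r, c) C) = f r c + arc_sum f C"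
    if "C \<subseteq> D" "C = {} \<or> (\<exists>j. arborescence C c j)" for C
  proof -
    show "insert (r, c) C \<subseteq> ?D"
      using that(1) by blast
    have "r \<notin> Field C"
      using extend.hyps(2) mono_Field[OF that(1)] by blast
    then show "\<exists>j. arborescence (insert (r, c) C) r j"
      using that(2) \<open>r \<noteq> c\<close> arborescence.edge arborescence.extend by metis
    have "(r, c) \<notin> C"
      using \<open>r \<notin> Field C\<close> by (auto simp: Field_def)
    then show "arc_sum f (insert (r, c) C) = f r c + arc_sum f C"
      using finite_subset[OF that(1) fin] by (rule arc_sum_insert[rotated])
  qed
  have "f r c = 1 \<or> f r c = -1"
    using extend.prems[of r c] by auto
  \<comment> \<open>If the small sum is nonnegative and the new arc positive, the empty subtree
    replaces \<open>B\<close>; a nonpositive large sum with a negative arc is symmetric. Otherwise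
    the arc joins both sets and the difference does not change.\<close>
  then consider "arc_sum f B \<le> -1" "f r c = 1" | "arc_sum f B \<ge> 0" "f r c = 1"
    | "arc_sum f A \<ge> 1" "f r c = -1" | "arc_sum f A \<le> 0" "f r c = -1"
    by linarith
  then show ?case
  proof cases
    case 1
    then show ?thesis
      using sub[OF A] sub[OF B] AB
      by (intro exI[of _ "insert (r, c) A"] exI[of _ "insert (r, c) B"]) simp
  next
    case 2
    then show ?thesis
      using sub[OF A] AB
      by (intro exI[of _ "insert (r, c) A"] exI[of _ "{}"]) simp
  next
    case 3
    then show ?thesis
      using sub[OF A] sub[OF B] AB
      by (intro exI[of _ "insert (r, c) A"] exI[of _ "insert (r, c) B"]) simp
  next
    case 4
    then show ?thesis
      using sub[OF B] AB
      by (intro exI[of _ "{}"] exI[of _ "insert (r, c) B"]) simp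
  qed
next
  case (join D1 r k1 D2 k2)
  obtain A1 B1 where A1: "A1 \<subseteq> D1" "A1 = {} \<or> (\<exists>j. arborescence A1 r j)"
    and B1: "B1 \<subseteq> D1" "B1 = {} \<or> (\<exists>j. arborescence B1 r j)"
    and AB1: "int k1 \<le> arc_sum f A1 - arc_sum f B1"
    using join.IH(1) join.prems by auto
  obtain A2 B2 where A2: "A2 \<subseteq> D2" "A2 = {} \<or> (\<exists>j. arborescence A2 r j)"
    and B2: "B2 \<subseteq> D2" "B2 = {} \<or> (\<exists>j. arborescence B2 r j)"
    and AB2: "int k2 \<le> arc_sum f A2 - arc_sum f B2"
    using join.IH(2) join.prems by auto
  \<comment> \<open>The head of a common arc would be the root.\<close>
  have "D1 \<inter> D2 = {}"
  proof (rule ccontr)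
    assume "D1 \<inter> D2 \<noteq> {}"
    then obtain u v where uv: "(u, v) \<in> D1" "(u, v) \<in> D2"
      by auto
    then have "v \<in> Field D1 \<inter> Field D2"
      by (auto simp: Field_def)
    then have "(u, r) \<in> D1"
      using uv join.hyps(3) by auto
    then show False
      using out_tree_root[OF arborescence_out_tree[OF join.hyps(1)]] by blast
  qed
  have sub: "C1 \<union> C2 \<subseteq> D1 \<union> D2" "C1 \<union> C2 = {} \<or> (\<exists>j. arborescence (C1 \<union> C2) r j)"
    "arc_sum f (C1 \<union> C2) = arc_sum f C1 + arc_sum f C2"
    if C1: "C1 \<subseteq> D1" "C1 = {} \<or> (\<exists>j. arborescence C1 r j)"
      and C2: "C2 \<subseteq> D2" "C2 = {} \<or> (\<exists>j. arborescence C2 r j)" for C1 C2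
  proof -
    show "C1 \<union> C2 \<subseteq> D1 \<union> D2"
      using C1(1) C2(1) by blast
    show "C1 \<union> C2 = {} \<or> (\<exists>j. arborescence (C1 \<union> C2) r j)"
    proof (cases "C1 = {} \<or> C2 = {}")
      case True
      then show ?thesis
        using C1(2) C2(2) by auto
    next
      case False
      then obtain j1 j2 where j: "arborescence C1 r j1" "arborescence C2 r j2"
        using C1(2) C2(2) by blast
      have "r \<in> Field C1" "r \<in> Field C2"
        using arborescence_root[OF j(1)] arborescence_root[OF j(2)] by (auto simp: Field_def)
      then have "Field C1 \<inter> Field C2 = {r}"
        using mono_Field[OF C1(1)] mono_Field[OF C2(1)] join.hyps(3) by blast
      then show ?thesis
        using arborescence.join[OF j] by blast
    qed
    show "arc_sum f (C1 \<union> C2) = arc_sum f C1 + arc_sum f C2"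
      using finite_subset[OF C1(1) arborescence_finite[OF join.hyps(1)]]
        finite_subset[OF C2(1) arborescence_finite[OF join.hyps(2)]] C1(1) C2(1) \<open>D1 \<inter> D2 = {}\<close>
      by (intro sum.union_disjoint) auto
  qed
  show ?case
    using sub[OF A1 A2] sub[OF B1 B2] AB1 AB2
    by (intro exI[of _ "A1 \<union> A2"] exI[of _ "B1 \<union> B2"] conjI) (assumption | simp)+
qed

section \<open>Upper bound\<close>

lemma out_tree_root_Domain:
  assumes "out_tree A r" "A \<noteq> {}"
  shows "r \<in> Domain A"
proof -
  obtain u v where uv: "(u, v) \<in> A"
    using assms(2) by auto
  have "(r, u) \<in> A\<^sup>*"
    using out_tree_reach[OF assms(1) uv] .
  then show ?thesis
    using uv by (cases rule: converse_rtranclE) auto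
qed

text \<open>The edge to \<open>c\<close> is the only one available at \<open>r\<close>. When it is
  used away from \<open>r\<close>, no arc enters \<open>r\<close>, so \<open>r\<close> must be the
  root, and every other vertex is reached through \<open>c\<close>.\<close>

lemma out_tree_remove_root_arc:
  assumes A: "out_tree A \<rho>" and rc: "(r, c) \<in> A"
    and sub: "A \<subseteq> insert (r, c) D \<union> (insert (r, c) D)\<inverse>" and "r \<notin> Field D"
  shows "\<rho> = r" and "out_tree (A - {(r, c)}) c"
proof -
  let ?A = "A - {(r, c)}"
  note D = out_treeD[OF A]
  have nbr: "x = c" if "(r, x) \<in> A \<or> (x, r) \<in> A" for x
    using that sub \<open>r \<notin> Field D\<close> unfolding Field_def by blast
  have no_in: "(x, r) \<notin> A" for x
    using nbr[of x] D(4)[OF rc] by blast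
  show "\<rho> = r"
    using D(1)[OF rc] no_in by (auto elim: rtranclE)
  have reach: "x = r \<or> (c, x) \<in> ?A\<^sup>*" if "(r, x) \<in> A\<^sup>*" for x
    using that
  proof (induction rule: rtrancl_induct)
    case (step x y)
    show ?case
    proof (cases "x = r")
      case True
      then show ?thesis
        using nbr step.hyps(2) by blast
    next
      case False
      then show ?thesis
        using step by (auto intro: rtrancl_into_rtrancl)
    qed
  qed simp
  show "out_tree ?A c"
  proof (rule out_treeI)
    show "(c, u) \<in> ?A\<^sup>*" if "(u, v) \<in> ?A" for u v
      using that reach[of u] D(1)[of u v] nbr[of v] \<open>\<rho> = r\<close> by blast
    show "u = w" if "(u, v) \<in> ?A" "(w, v) \<in> ?A" for u v w
      using that D(2) by blast
    show "(u, c) \<notin> ?A" for u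
      using D(2)[OF rc, of u] by blast
    show "(v, u) \<notin> ?A" if "(u, v) \<in> ?A" for u v
      using that D(4) by blast
  qed
qed

text \<open>Here the edge is used towards \<open>r\<close>, which makes \<open>r\<close> a sink of
  \<open>A\<close>; cutting it off keeps the root. By the third conclusion the bound for subtrees
  containing \<open>c\<close> applies to the rest.\<close>

lemma out_tree_remove_pendant_arc:
  assumes A: "out_tree A \<rho>" and cr: "(c, r) \<in> A"
    and sub: "A \<subseteq> insert (r, c) D \<union> (insert (r, c) D)\<inverse>" and "r \<notin> Field D"
  shows "\<rho> \<noteq> r" and "out_tree (A - {(c, r)}) \<rho>" and "(\<rho>, c) \<in> (A - {(c, r)})\<^sup>*"
proof -
  let ?A = "A - {(c, r)}"
  note D = out_treeD[OF A]
  have no_out: "(r, x) \<notin> A" for x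
    using sub \<open>r \<notin> Field D\<close> D(4)[OF cr] unfolding Field_def by blast
  show "\<rho> \<noteq> r"
    using D(3) cr by blast
  have reach: "x = r \<or> (\<rho>, x) \<in> ?A\<^sup>*" if "(\<rho>, x) \<in> A\<^sup>*" for x
    using that
  proof (induction rule: rtrancl_induct)
    case (step x y)
    then have "(\<rho>, x) \<in> ?A\<^sup>*"
      using no_out by blast
    then show ?case
      using step.hyps(2) by (cases "y = r") (auto intro: rtrancl_into_rtrancl)
  qed simp
  show "out_tree ?A \<rho>"
  proof (rule out_treeI)
    show "(\<rho>, u) \<in> ?A\<^sup>*" if "(u, v) \<in> ?A" for u v
      using that reach[of u] D(1)[of u v] no_out[of v] by blast
    show "u = w" if "(u, v) \<in> ?A" "(w, v) \<in> ?A" for u v w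
      using that D(2) by blast
    show "(u, \<rho>) \<notin> ?A" for u
      using D(3) by blast
    show "(v, u) \<notin> ?A" if "(u, v) \<in> ?A" for u v
      using that D(4) by blast
  qed
  show "(\<rho>, c) \<in> ?A\<^sup>*"
    using reach[OF D(1)[OF cr]] cr no_out by blast
qed

text \<open>The root is not a vertex of \<open>A2\<close> unless it is \<open>r\<close>, and the
  parts meet only at \<open>r\<close>. So \<open>A2\<close> can be entered only through
  \<open>r\<close> and hangs there as an out-tree of its own.\<close>

lemma out_tree_split:
  assumes A: "out_tree (A1 \<union> A2) \<rho>" and meet: "Field A1 \<inter> Field A2 \<subseteq> {r}"
    and root: "\<rho> \<in> Field A2 \<longrightarrow> \<rho> = r"
  shows "out_tree A1 \<rho>" and "out_tree A2 r"
    and "(\<rho>, r) \<in> (A1 \<union> A2)\<^sup>* \<Longrightarrow> (\<rho>, r) \<in> A1\<^sup>*" and "A1 \<inter> A2 = {}"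
proof -
  note D = out_treeD[OF A]
  have meet: "x = r" if "x \<in> Field A1" "x \<in> Field A2" for x
    using that meet by blast
  have ends: "x = y \<or> x \<in> Field B" if "(y, x) \<in> B\<^sup>*" for x y and B :: "('a \<times> 'a) set"
    using that by (cases rule: rtranclE) (auto simp: Field_def)
  have arc: "u \<in> Field B" "v \<in> Field B" if "(u, v) \<in> B" for u v and B :: "('a \<times> 'a) set"
    using that by (auto simp: Field_def)
  \<comment> \<open>Invariant along a path from the root: the vertex is reached inside
    \<open>A1\<close>, or \<open>r\<close> is reached inside \<open>A1\<close> and the rest of the
    way lies in \<open>A2\<close>.\<close>
  have reach: "(\<rho>, x) \<in> A1\<^sup>* \<or> (r, x) \<in> A2\<^sup>* \<and> (\<rho>, r) \<in> A1\<^sup>*" if "(\<rho>, x) \<in> (A1 \<union> A2)\<^sup>*" for x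
    using that
  proof (induction rule: rtrancl_induct)
    case (step x y)
    from step.hyps(2) show ?case
    proof
      assume xy: "(x, y) \<in> A1"
      have "(\<rho>, x) \<in> A1\<^sup>*"
        using step.IH ends[of r x A2] meet[of x] arc(1)[OF xy] by blast
      then show ?thesis
        using xy by (blast intro: rtrancl_into_rtrancl)
    next
      assume xy: "(x, y) \<in> A2"
      have "(r, x) \<in> A2\<^sup>* \<and> (\<rho>, r) \<in> A1\<^sup>*"
        using step.IH ends[of \<rho> x A1] meet[of x] arc(1)[OF xy] root by blast
      then show ?thesis
        using xy by (blast intro: rtrancl_into_rtrancl)
    qed
  qed simp
  show r: "(\<rho>, r) \<in> A1\<^sup>*" if "(\<rho>, r) \<in> (A1 \<union> A2)\<^sup>*"
    using reach[OF that] by blast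
  show "A1 \<inter> A2 = {}"
  proof (rule ccontr)
    assume "A1 \<inter> A2 \<noteq> {}"
    then obtain u v where uv: "(u, v) \<in> A1" "(u, v) \<in> A2"
      by auto
    then have "u = r" "v = r"
      using meet arc by blast+
    then show False
      using uv D(4) by blast
  qed
  show "out_tree A1 \<rho>"
  proof (rule out_treeI)
    show "(\<rho>, u) \<in> A1\<^sup>*" if uv: "(u, v) \<in> A1" for u v
    proof -
      have "(\<rho>, u) \<in> (A1 \<union> A2)\<^sup>*"
        using D(1) uv by blast
      then show ?thesis
        using reach[of u] ends[of r u A2] meet[of u] arc(1)[OF uv] by blast
    qed
    show "u = w" if "(u, v) \<in> A1" "(w, v) \<in> A1" for u v w
      using that D(2) by blast
    show "(u, \<rho>) \<notin> A1" for u
      using D(3) by blast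
    show "(v, u) \<notin> A1" if "(u, v) \<in> A1" for u v
      using that D(4) by blast
  qed
  show "out_tree A2 r"
  proof (rule out_treeI)
    show "(r, u) \<in> A2\<^sup>*" if uv: "(u, v) \<in> A2" for u v
    proof -
      have "(\<rho>, u) \<in> (A1 \<union> A2)\<^sup>*"
        using D(1) uv by blast
      then show ?thesis
        using reach[of u] ends[of \<rho> u A1] meet[of u] arc(1)[OF uv] root by blast
    qed
    show "u = w" if "(u, v) \<in> A2" "(w, v) \<in> A2" for u v w
      using that D(2) by blast
    show "(u, r) \<notin> A2" for u
    proof
      assume ur: "(u, r) \<in> A2"
      have "(\<rho>, u) \<in> (A1 \<union> A2)\<^sup>*"
        using D(1) ur by blast
      then have "(\<rho>, r) \<in> (A1 \<union> A2)\<^sup>*"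
        using ur by (blast intro: rtrancl_into_rtrancl)
      then have "(\<rho>, r) \<in> A1\<^sup>*"
        by (rule r)
      moreover have "\<rho> \<noteq> r"
        using D(3) ur by blast
      ultimately obtain w where w: "(w, r) \<in> A1"
        by (auto elim: rtranclE)
      then have "w = u"
        using D(2) ur by blast
      then have "u = r"
        using meet arc(1)[OF w] arc(1)[OF ur] by blast
      then show False
        using ur D(4) by blast
    qed
    show "(v, u) \<notin> A2" if "(u, v) \<in> A2" for u v
      using that D(4) by blast
  qed
qed

section \<open>Signings and bounds on their sums\<close>

definition signing :: "('a \<Rightarrow> 'a \<Rightarrow> int) \<Rightarrow> ('a \<times> 'a) set \<Rightarrow> bool" where
  "signing f D \<longleftrightarrow> (\<forall>u v. f v u = - f u v) \<and> (\<forall>u v. (u, v) \<in> D \<longrightarrow> \<bar>f u v\<bar> = 1)"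

text \<open>The three bounds concern the subtrees with root \<open>r\<close>, those containing \<open>r\<close>, and all of them. Here
  \<open>p\<close> and \<open>n\<close> count the heavy paths starting with sign \<open>1\<close> and \<open>-1\<close>, \<open>h\<close> is the starting sign of the
  heavy path at \<open>r\<close>, and \<open>l\<close> bounds the number of light arcs on a path from \<open>r\<close>. The dependence on \<open>h\<close>
  keeps the bounds from growing when an arc is added at the top of a heavy path.\<close>

definition bounded_sums ::
  "('a \<Rightarrow> 'a \<Rightarrow> int) \<Rightarrow> ('a \<times> 'a) set \<Rightarrow> 'a \<Rightarrow> int \<Rightarrow> int \<Rightarrow> int \<Rightarrow> int \<Rightarrow> bool" where
  "bounded_sums f D r p n h l \<longleftrightarrow> (\<forall>A \<rho>. out_tree A \<rho> \<longrightarrow> A \<subseteq> D \<union> D\<inverse> \<longrightarrow>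
     (\<rho> = r \<longrightarrow> - n \<le> arc_sum f A \<and> arc_sum f A \<le> p) \<and>
     ((\<rho>, r) \<in> A\<^sup>* \<longrightarrow> - (n + 2 * l + 1 + h) \<le> arc_sum f A \<and> arc_sum f A \<le> p + 2 * l + 1 - h) \<and>
     - (2 * n + 4 * l + 3 + h) \<le> 2 * arc_sum f A \<and> 2 * arc_sum f A \<le> 2 * p + 4 * l + 3 - h)"

lemma signingD:
  assumes "signing f D"
  shows signing_antisym: "f v u = - f u v" and signing_abs: "(u, v) \<in> D \<Longrightarrow> \<bar>f u v\<bar> = 1"
  using assms unfolding signing_def by blast+

lemma bounded_sumsD:
  assumes "bounded_sums f D r p n h l" "out_tree A \<rho>" "A \<subseteq> D \<union> D\<inverse>"
  shows "\<rho> = r \<Longrightarrow> - n \<le> arc_sum f A \<and> arc_sum f A \<le> p"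
    and "(\<rho>, r) \<in> A\<^sup>* \<Longrightarrow>
      - (n + 2 * l + 1 + h) \<le> arc_sum f A \<and> arc_sum f A \<le> p + 2 * l + 1 - h"
    and "- (2 * n + 4 * l + 3 + h) \<le> 2 * arc_sum f A \<and> 2 * arc_sum f A \<le> 2 * p + 4 * l + 3 - h"
  using assms unfolding bounded_sums_def by blast+

lemma bounded_sums_cong:
  assumes "bounded_sums f D r p n h l" and eq: "\<And>u v. (u, v) \<in> D \<union> D\<inverse> \<Longrightarrow> f u v = g u v"
  shows "bounded_sums g D r p n h l"
proof -
  have "arc_sum f A = arc_sum g A" if "A \<subseteq> D \<union> D\<inverse>" for A
    using that eq by (intro sum.cong) auto
  then show ?thesis
    using assms(1) unfolding bounded_sums_def by simp
qed

text \<open>The new arc prolongs the heavy path at \<open>c\<close> upwards. Signs alternate, so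
  this path starts with \<open>- h\<close> at \<open>c\<close> and with \<open>h\<close> at
  \<open>r\<close>. That moves one path from one count to the other, whence \<open>p - h\<close> and
  \<open>n + h\<close>.\<close>

lemma bounded_sums_extend:
  assumes f: "bounded_sums f D c (p - h) (n + h) (- h) l" and asym: "f r c = h" "f c r = - h"
    and r: "r \<notin> Field D" "finite D"
    and nonneg: "0 \<le> p" "0 \<le> n" "0 \<le> l" and h: "h = 1 \<or> h = -1"
  shows "bounded_sums f (insert (r, c) D) r p n h l"
  unfolding bounded_sums_def
proof (intro allI impI)
  fix A \<rho>
  assume A: "out_tree A \<rho>" and sub: "A \<subseteq> insert (r, c) D \<union> (insert (r, c) D)\<inverse>"
  have fin: "finite A"
    using finite_subset[OF sub] r(2) by auto
  let ?S = "arc_sum f A"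
  have "(\<rho> = r \<longrightarrow> - n \<le> ?S \<and> ?S \<le> p) \<and>
     ((\<rho>, r) \<in> A\<^sup>* \<longrightarrow> - (n + 2 * l + 1 + h) \<le> ?S \<and> ?S \<le> p + 2 * l + 1 - h) \<and>
     - (2 * n + 4 * l + 3 + h) \<le> 2 * ?S \<and> 2 * ?S \<le> 2 * p + 4 * l + 3 - h"
  proof (cases "(r, c) \<in> A")
    case True
    note rem = out_tree_remove_root_arc[OF A True sub r(1)]
    have "(c, r) \<notin> A"
      using out_tree_asym[OF A True] .
    then have "A - {(r, c)} \<subseteq> D \<union> D\<inverse>"
      using sub by blast
    \<comment> \<open>The shift of the counts by \<open>h\<close> cancels against the sign
      \<open>h\<close> of the new arc.\<close>
    then have "- (n + h) \<le> arc_sum f (A - {(r, c)}) \<and> arc_sum f (A - {(r, c)}) \<le> p - h"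
      using bounded_sumsD(1)[OF f rem(2)] by blast
    moreover have "?S = h + arc_sum f (A - {(r, c)})"
      using sum.remove[OF fin True, of "\<lambda>(u, v). f u v"] asym by simp
    ultimately have "- n \<le> ?S" "?S \<le> p"
      by linarith+
    then show ?thesis
      using nonneg h by auto
  next
    case rc: False
    show ?thesis
    proof (cases "(c, r) \<in> A")
      case True
      note rem = out_tree_remove_pendant_arc[OF A True sub r(1)]
      have "A - {(c, r)} \<subseteq> D \<union> D\<inverse>"
        using sub rc by blast
      \<comment> \<open>The second bound at \<open>c\<close> becomes free of \<open>h\<close>; the
        arc, used backwards, adds \<open>- h\<close> and yields the second bound at
        \<open>r\<close>. Doubling gives the third bound above because
        \<open>2 - 2 * h \<le> 3 - h\<close>, and similarly below.\<close>
      then have "- (n + h + 2 * l + 1 - h) \<le> arc_sum f (A - {(c, r)})"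
        "arc_sum f (A - {(c, r)}) \<le> p - h + 2 * l + 1 + h"
        using bounded_sumsD(2)[OF f rem(2)] rem(3) by auto
      moreover have "?S = - h + arc_sum f (A - {(c, r)})"
        using sum.remove[OF fin True, of "\<lambda>(u, v). f u v"] asym by simp
      ultimately have "- (n + 2 * l + 1 + h) \<le> ?S" "?S \<le> p + 2 * l + 1 - h"
        by linarith+
      then show ?thesis
        using h rem(1) by auto
    next
      case False
      then have AD: "A \<subseteq> D \<union> D\<inverse>"
        using sub rc by blast
      then have "r \<notin> Field A"
        using r(1) unfolding Field_def by blast
      have empty: "A = {}" if "(\<rho>, r) \<in> A\<^sup>*"
      proof -
        have "\<rho> = r"
          using that \<open>r \<notin> Field A\<close> by (auto elim: rtranclE simp: Field_def)
        then show ?thesis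
          using out_tree_root_Domain[OF A] \<open>r \<notin> Field A\<close> by (auto simp: Field_def)
      qed
      have "?S = 0" if "(\<rho>, r) \<in> A\<^sup>*"
        using empty[OF that] by simp
      moreover have "(\<rho>, r) \<in> A\<^sup>*" if "\<rho> = r"
        using that by simp
      \<comment> \<open>The third bounds at \<open>c\<close> and at \<open>r\<close> agree since
        \<open>2 * (p - h) + h = 2 * p - h\<close>; this is why \<open>h\<close> has half the weight
        there.\<close>
      moreover have "- (2 * (n + h) + 4 * l + 3 - h) \<le> 2 * ?S"
        "2 * ?S \<le> 2 * (p - h) + 4 * l + 3 + h"
        using bounded_sumsD(3)[OF f A AD] by auto
      ultimately show ?thesis
        using nonneg h by auto
    qed
  qed
  then show "(\<rho> = r \<longrightarrow> - n \<le> ?S \<and> ?S \<le> p) \<and>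
     ((\<rho>, r) \<in> A\<^sup>* \<longrightarrow> - (n + 2 * l + 1 + h) \<le> ?S \<and> ?S \<le> p + 2 * l + 1 - h) \<and>
     - (2 * n + 4 * l + 3 + h) \<le> 2 * ?S \<and> 2 * ?S \<le> 2 * p + 4 * l + 3 - h" .
qed

text \<open>The heavy path at \<open>r\<close> runs in \<open>D1\<close>, and \<open>D2\<close> is
  the light side. With the root in \<open>D1\<close>, the part in \<open>D2\<close> is rooted at
  \<open>r\<close> and obeys the first bound. With the root in \<open>D2\<close>, the sign in the
  bounds changes from \<open>h2\<close> to \<open>h\<close>, and \<open>l2 + 1 \<le> l\<close> pays
  for this difference of at most 2.\<close>

lemma bounded_sums_join:
  assumes f1: "bounded_sums f D1 r p1 n1 h l1" and f2: "bounded_sums f D2 r p2 n2 h2 l2"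
    and meet: "Field D1 \<inter> Field D2 = {r}" and fin: "finite D1" "finite D2"
    and l: "l1 \<le> l" "l2 + 1 \<le> l" and h: "h = 1 \<or> h = -1" "h2 = 1 \<or> h2 = -1"
  shows "bounded_sums f (D1 \<union> D2) r (p1 + p2) (n1 + n2) h l"
  unfolding bounded_sums_def
proof (intro allI impI)
  fix A \<rho>
  assume A: "out_tree A \<rho>" and sub: "A \<subseteq> D1 \<union> D2 \<union> (D1 \<union> D2)\<inverse>"
  define A1 where "A1 = A \<inter> (D1 \<union> D1\<inverse>)"
  define A2 where "A2 = A \<inter> (D2 \<union> D2\<inverse>)"
  have A12: "A = A1 \<union> A2" and sub1: "A1 \<subseteq> D1 \<union> D1\<inverse>" and sub2: "A2 \<subseteq> D2 \<union> D2\<inverse>"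
    using sub unfolding A1_def A2_def by blast+
  have Field1: "Field A1 \<subseteq> Field D1" and Field2: "Field A2 \<subseteq> Field D2"
    using sub1 sub2 unfolding Field_def by blast+
  have fin: "finite A1" "finite A2"
    using finite_subset[OF sub1] finite_subset[OF sub2] fin by auto
  have sum: "arc_sum f A = arc_sum f A1 + arc_sum f A2" if "A1 \<inter> A2 = {}"
    unfolding A12 using fin that by (rule sum.union_disjoint)
  let ?S = "arc_sum f A"
  have "A \<noteq> {} \<Longrightarrow> \<rho> \<in> Field A1 \<union> Field A2"
    using out_tree_root_Domain[OF A] unfolding A12 Field_def by blast
  then have "(\<rho> \<in> Field A2 \<longrightarrow> \<rho> = r) \<or> (\<rho> \<in> Field A1 \<longrightarrow> \<rho> = r)"
    using Field1 Field2 meet by blast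
  then show "(\<rho> = r \<longrightarrow> - (n1 + n2) \<le> ?S \<and> ?S \<le> p1 + p2) \<and>
     ((\<rho>, r) \<in> A\<^sup>* \<longrightarrow> - (n1 + n2 + 2 * l + 1 + h) \<le> ?S \<and> ?S \<le> p1 + p2 + 2 * l + 1 - h) \<and>
     - (2 * (n1 + n2) + 4 * l + 3 + h) \<le> 2 * ?S \<and> 2 * ?S \<le> 2 * (p1 + p2) + 4 * l + 3 - h"
  proof
    assume root: "\<rho> \<in> Field A2 \<longrightarrow> \<rho> = r"
    have "Field A1 \<inter> Field A2 \<subseteq> {r}"
      using Field1 Field2 meet by blast
    note split = out_tree_split[OF A[unfolded A12] this root]
    note b1 = bounded_sumsD[OF f1 split(1) sub1]
    note b2 = bounded_sumsD(1)[OF f2 split(2) sub2 refl]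
    show ?thesis
      using b1 b2 split(3) sum[OF split(4)] l unfolding A12[symmetric] by fastforce
  next
    assume root: "\<rho> \<in> Field A1 \<longrightarrow> \<rho> = r"
    have meet': "Field A2 \<inter> Field A1 \<subseteq> {r}"
      using Field1 Field2 meet by blast
    have A': "out_tree (A2 \<union> A1) \<rho>"
      using A A12 by (simp add: Un_commute)
    note split = out_tree_split[OF A' meet' root]
    note b2 = bounded_sumsD[OF f2 split(1) sub2]
    note b1 = bounded_sumsD(1)[OF f1 split(2) sub1 refl]
    have "A1 \<inter> A2 = {}"
      using split(4) by blast
    note S = sum[OF this]
    have "\<rho> = r \<Longrightarrow> - (n1 + n2) \<le> ?S \<and> ?S \<le> p1 + p2"
      using b1 b2(1) S by linarith
    moreover have "- (2 * (n1 + n2) + 4 * l2 + 3 + h2) \<le> 2 * ?S \<and>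
      2 * ?S \<le> 2 * (p1 + p2) + 4 * l2 + 3 - h2"
      using b1 b2(3) unfolding S by (intro conjI) simp_all
    moreover have "- (n1 + n2 + 2 * l2 + 1 + h2) \<le> ?S \<and> ?S \<le> p1 + p2 + 2 * l2 + 1 - h2"
      if "(\<rho>, r) \<in> A\<^sup>*"
      using b1 b2(2) split(3) that S unfolding A12 Un_commute[of A1] by linarith
    ultimately show ?thesis
      using l h by auto
  qed
qed

section \<open>Distributing the starting signs over the heavy paths\<close>

definition target :: "nat \<Rightarrow> int \<Rightarrow> int \<Rightarrow> int \<Rightarrow> bool" where
  "target k p n h \<longleftrightarrow> 0 \<le> p \<and> 0 \<le> n \<and> p + n = int k \<and> (h = 1 \<and> 1 \<le> p \<or> h = -1 \<and> 1 \<le> n)"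

text \<open>All targets are demanded because the induction dictates how many starting signs of each
  kind a part receives. The heavy path at the root, of sign \<open>h\<close>, must be among the
  paths counted by the target.\<close>

definition balanceable :: "('a \<times> 'a) set \<Rightarrow> 'a \<Rightarrow> nat \<Rightarrow> nat \<Rightarrow> bool" where
  "balanceable D r k l \<longleftrightarrow>
     (\<forall>p n h. target k p n h \<longrightarrow> (\<exists>f. signing f D \<and> bounded_sums f D r p n h (int l)))"

text \<open>The first part receives as many starting signs \<open>h\<close> as it can hold, hence at
  least one. Since \<open>k2\<close> is positive, some sign is left for the second part, and
  \<open>h2\<close> is chosen among those left.\<close>

lemma target_split:
  assumes "target (k1 + k2) p n h" "k1 > 0" "k2 > 0"
  obtains p1 n1 p2 n2 h2 where "target k1 p1 n1 h" "target k2 p2 n2 h2" "p = p1 + p2" "n = n1 + n2"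
proof (cases "h = 1")
  case True
  define p1 where "p1 = min p (int k1)"
  have "target k1 p1 (int k1 - p1) h"
    "target k2 (p - p1) (n - (int k1 - p1)) (if p - p1 \<ge> 1 then 1 else -1)"
    using assms True by (auto simp: target_def p1_def)
  then show ?thesis
    using that by fastforce
next
  case False
  define n1 where "n1 = min n (int k1)"
  have "target k1 (int k1 - n1) n1 h"
    "target k2 (p - (int k1 - n1)) (n - n1) (if n - n1 \<ge> 1 then -1 else 1)"
    using assms False by (auto simp: target_def n1_def)
  then show ?thesis
    using that by fastforce
qed

lemma balanceable_join:
  assumes D1: "balanceable D1 r k1 l1" "out_tree D1 r" "finite D1" "k1 > 0"
    and D2: "balanceable D2 r k2 l2" "out_tree D2 r" "finite D2" "k2 > 0"
    and meet: "Field D1 \<inter> Field D2 = {r}"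
  shows "balanceable (D1 \<union> D2) r (k1 + k2) (max l1 (Suc l2))"
  unfolding balanceable_def
proof (intro allI impI)
  fix p n h
  assume "target (k1 + k2) p n h"
  then obtain p1 n1 p2 n2 h2 where t: "target k1 p1 n1 h" "target k2 p2 n2 h2"
    and pn: "p = p1 + p2" "n = n1 + n2"
    using target_split D1(4) D2(4) by blast
  obtain f1 where f1: "signing f1 D1" "bounded_sums f1 D1 r p1 n1 h (int l1)"
    using t(1) D1(1) unfolding balanceable_def by blast
  obtain f2 where f2: "signing f2 D2" "bounded_sums f2 D2 r p2 n2 h2 (int l2)"
    using t(2) D2(1) unfolding balanceable_def by blast
  \<comment> \<open>The parts share only \<open>r\<close>, and \<open>(r, r)\<close> is no arc, so
    an arc of \<open>D2\<close> never has both ends in \<open>Field D1\<close>.\<close>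
  define f where "f u v = (if u \<in> Field D1 \<and> v \<in> Field D1 then f1 u v else f2 u v)" for u v
  have eq1: "f1 u v = f u v" if "(u, v) \<in> D1 \<union> D1\<inverse>" for u v
  proof -
    have "u \<in> Field D1" "v \<in> Field D1"
      using that by (auto simp: Field_def)
    then show ?thesis
      by (simp add: f_def)
  qed
  have eq2: "f2 u v = f u v" if "(u, v) \<in> D2 \<union> D2\<inverse>" for u v
  proof -
    have uv: "u \<in> Field D2" "v \<in> Field D2"
      using that by (auto simp: Field_def)
    have "(r, r) \<notin> D2"
      using out_tree_root[OF D2(2)] .
    then have "\<not> (u = r \<and> v = r)"
      using that by auto
    then have "\<not> (u \<in> Field D1 \<and> v \<in> Field D1)"
      using uv meet by blast
    then show ?thesis
      by (auto simp: f_def)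
  qed
  have "signing f (D1 \<union> D2)"
    unfolding signing_def
  proof (intro conjI allI impI)
    show "f v u = - f u v" for u v
      using signing_antisym[OF f1(1), of v u] signing_antisym[OF f2(1), of v u] by (simp add: f_def)
    show "\<bar>f u v\<bar> = 1" if "(u, v) \<in> D1 \<union> D2" for u v
      using that eq1[of u v] eq2[of u v] signing_abs[OF f1(1), of u v] signing_abs[OF f2(1), of u v]
      by auto
  qed
  moreover have "bounded_sums f (D1 \<union> D2) r p n h (int (max l1 (Suc l2)))"
    unfolding pn
  proof (rule bounded_sums_join)
    show "bounded_sums f D1 r p1 n1 h (int l1)"
      using f1(2) eq1 by (rule bounded_sums_cong)
    show "bounded_sums f D2 r p2 n2 h2 (int l2)"
      using f2(2) eq2 by (rule bounded_sums_cong)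
    show "h = 1 \<or> h = -1" "h2 = 1 \<or> h2 = -1"
      using t by (auto simp: target_def)
  qed (use meet D1(3) D2(3) in auto)
  ultimately show "\<exists>f. signing f (D1 \<union> D2) \<and>
      bounded_sums f (D1 \<union> D2) r p n h (int (max l1 (Suc l2)))"
    by blast
qed

lemma signing_extend:
  assumes f: "signing f D" "bounded_sums f D c (p - h) (n + h) (- h) l"
    and r: "r \<notin> Field D" "r \<noteq> c" "finite D"
    and "0 \<le> p" "0 \<le> n" "0 \<le> l" and h: "h = 1 \<or> h = -1"
  shows "\<exists>f. signing f (insert (r, c) D) \<and> bounded_sums f (insert (r, c) D) r p n h l"
proof -
  define g where "g u v = (if u = r \<and> v = c then h else if u = c \<and> v = r then - h else f u v)" for u v
  have eq: "f u v = g u v" if "(u, v) \<in> D \<union> D\<inverse>" for u v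
  proof -
    have "u \<noteq> r" "v \<noteq> r"
      using that r(1) by (auto simp: Field_def)
    then show ?thesis
      by (simp add: g_def)
  qed
  have "signing g (insert (r, c) D)"
    unfolding signing_def
  proof (intro conjI allI impI)
    show "g v u = - g u v" for u v
      using signing_antisym[OF f(1), of v u] r(2) by (auto simp: g_def)
    show "\<bar>g u v\<bar> = 1" if "(u, v) \<in> insert (r, c) D" for u v
    proof (cases "(u, v) \<in> D")
      case True
      then show ?thesis
        using eq[of u v] signing_abs[OF f(1) True] by simp
    next
      case False
      then show ?thesis
        using that h by (auto simp: g_def)
    qed
  qed
  moreover have "bounded_sums g (insert (r, c) D) r p n h l"
  proof (rule bounded_sums_extend)
    show "bounded_sums g D c (p - h) (n + h) (- h) l"
      using f(2) eq by (rule bounded_sums_cong)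
  qed (use assms in \<open>auto simp: g_def\<close>)
  ultimately show ?thesis
    by blast
qed

text \<open>At a \<open>join\<close> the part with fewer sinks is taken as the light one. Each
  increase of \<open>l\<close> through a light part thus comes with at least a doubling of its
  number of sinks, which keeps \<open>l\<close> logarithmic in \<open>k\<close>.\<close>

lemma arborescence_balanceable:
  assumes "arborescence D r k"
  shows "\<exists>l. 2 ^ l \<le> k \<and> balanceable D r k l"
  using assms
proof (induction rule: arborescence.induct)
  case (edge r c)
  have "balanceable {(r, c)} r 1 0"
    unfolding balanceable_def
  proof (intro allI impI)
    fix p n h
    assume t: "target 1 p n h"
    \<comment> \<open>A single arc is an extension of the empty set, where all sums are 0 and the
      shifted counts are still nonnegative.\<close>
    have "signing (\<lambda>_ _. 0) {}" "bounded_sums (\<lambda>_ _. 0) {} c (p - h) (n + h) (- h) (int 0)"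
      using t by (auto simp: signing_def bounded_sums_def target_def)
    then show "\<exists>f. signing f {(r, c)} \<and> bounded_sums f {(r, c)} r p n h (int 0)"
      using t edge.hyps by (intro signing_extend) (auto simp: target_def)
  qed
  then show ?case
    by (intro exI[of _ 0]) simp
next
  case (extend D c k r)
  then obtain l where l: "2 ^ l \<le> k" "balanceable D c k l"
    by blast
  have "r \<noteq> c"
    using arborescence_root[OF extend.hyps(1)] extend.hyps(2) by (auto simp: Field_def)
  have "balanceable (insert (r, c) D) r k l"
    unfolding balanceable_def
  proof (intro allI impI)
    fix p n h
    assume t: "target k p n h"
    then have "target k (p - h) (n + h) (- h)"
      by (auto simp: target_def)
    then obtain f where "signing f D" "bounded_sums f D c (p - h) (n + h) (- h) (int l)"
      using l(2) unfolding balanceable_def by blast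
    then show "\<exists>f. signing f (insert (r, c) D) \<and> bounded_sums f (insert (r, c) D) r p n h (int l)"
      using t \<open>r \<noteq> c\<close> extend.hyps(2) arborescence_finite[OF extend.hyps(1)]
      by (intro signing_extend) (auto simp: target_def)
  qed
  then show ?case
    using l(1) by blast
next
  case (join D1 r k1 D2 k2)
  obtain l1 l2 where l1: "2 ^ l1 \<le> k1" "balanceable D1 r k1 l1"
    and l2: "2 ^ l2 \<le> k2" "balanceable D2 r k2 l2"
    using join.IH by blast
  note D1 = arborescence_out_tree[OF join.hyps(1)] arborescence_finite[OF join.hyps(1)]
    arborescence_pos[OF join.hyps(1)]
  note D2 = arborescence_out_tree[OF join.hyps(2)] arborescence_finite[OF join.hyps(2)]
    arborescence_pos[OF join.hyps(2)]
  show ?case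
  proof (cases "k2 \<le> k1")
    case True
    have "2 ^ max l1 (Suc l2) \<le> k1 + k2"
      using l1(1) l2(1) True by (auto simp: max_def)
    then show ?thesis
      using balanceable_join[OF l1(2) D1 l2(2) D2 join.hyps(3)] by blast
  next
    case False
    have "2 ^ max l2 (Suc l1) \<le> k1 + k2"
      using l1(1) l2(1) False by (auto simp: max_def)
    moreover have "Field D2 \<inter> Field D1 = {r}"
      using join.hyps(3) by blast
    then have "balanceable (D1 \<union> D2) r (k1 + k2) (max l2 (Suc l1))"
      using balanceable_join[OF l2(2) D2 l1(2) D1] by (simp only: Un_commute add.commute)
    ultimately show ?thesis
      by blast
  qed
qed

section \<open>The discrepancy\<close>

text \<open>Two sums that differ by at least \<open>k\<close> cannot both have absolute value below
  \<open>k / 2\<close>, and both enter the maximum. This holds for every orientation, hence for the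
  minimum.\<close>

lemma oriented_discrepancy_ge:
  assumes "is_tree T" "arborescence D r k" "edges D = T"
  shows "int k \<le> 2 * oriented_discrepancy T"
proof -
  let ?M = "\<lambda>\<sigma>. MAX (T', \<sigma>')\<in>rooted_subtrees T. \<bar>\<Sum>e\<in>T'. agreement \<sigma> \<sigma>' e\<bar>"
  have "int k \<le> 2 * ?M \<sigma>" for \<sigma>
  proof -
    let ?f = "\<lambda>u v. if (u, v) \<in> \<sigma> then 1 else -1 :: int"
    have bound: "\<bar>arc_sum ?f A\<bar> \<le> ?M \<sigma>" if A: "A \<subseteq> D" "A = {} \<or> (\<exists>j. arborescence A r j)" for A
    proof -
      have "(edges A, A) \<in> rooted_subtrees T"
      proof (cases "A = {}")
        case True
        then show ?thesis
          by (simp add: rooted_subtrees_def subtree_def edge_connected_def is_orientation_def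
              bij_betw_def)
      next
        case False
        then obtain j where "arborescence A r j"
          using A(2) by blast
        moreover have "edges A \<subseteq> T"
          unfolding assms(3)[symmetric] using A(1) by (rule image_mono)
        ultimately show ?thesis
          by (rule arborescence_rooted_subtree)
      qed
      then have "\<bar>\<Sum>e\<in>edges A. agreement \<sigma> A e\<bar> \<le> ?M \<sigma>"
        using finite_rooted_subtrees[OF assms(1)] by (intro Max_ge) force+
      moreover have "(v, u) \<notin> A" if "(u, v) \<in> A" for u v
        using out_tree_asym[OF arborescence_out_tree[OF assms(2)]] that \<open>A \<subseteq> D\<close> by blast
      ultimately show ?thesis
        using sum_agreement[of A \<sigma>] by simp
    qed
    obtain A B where "\<bar>arc_sum ?f A\<bar> \<le> ?M \<sigma>" "\<bar>arc_sum ?f B\<bar> \<le> ?M \<sigma>"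
      "int k \<le> arc_sum ?f A - arc_sum ?f B"
    proof -
      have "\<bar>?f u v\<bar> = 1" for u v
        by simp
      then show ?thesis
        using that lower_bound_subtrees[OF assms(2), of ?f] bound by blast
    qed
    then show ?thesis
      by linarith
  qed
  moreover have "oriented_discrepancy T \<in> ?M ` {\<sigma>. is_orientation \<sigma> T}"
    unfolding oriented_discrepancy_def
    using finite_orientations[OF assms(1)] orientations_nonempty[OF assms(1)]
    by (intro Min_in) auto
  ultimately show ?thesis
    by auto
qed

lemma oriented_discrepancy_le:
  assumes "is_tree T" "arborescence D r k" "edges D = T"
  shows "\<exists>l. 2 ^ l \<le> k \<and> 2 * oriented_discrepancy T \<le> int k + 4 * int l + 5"
proof -
  obtain l where l: "2 ^ l \<le> k" "balanceable D r k l"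
    using arborescence_balanceable[OF assms(2)] by blast
  \<comment> \<open>Half of the starting signs are negative, rounded down, so \<open>p\<close> is
    positive and the starting sign 1 at the root is admissible.\<close>
  define n where "n = int k div 2"
  define p where "p = int k - n"
  have "target k p n 1"
    using arborescence_pos[OF assms(2)] by (auto simp: target_def p_def n_def)
  then obtain f where f: "signing f D" "bounded_sums f D r p n 1 (int l)"
    using l(2) unfolding balanceable_def by blast
  have anti: "f v u = - f u v" for u v
    using signing_antisym[OF f(1)] .
  have abs: "f u v = 1 \<or> f u v = -1" if "(u, v) \<in> D \<union> D\<inverse>" for u v
  proof -
    have "\<bar>f u v\<bar> = 1 \<or> \<bar>f v u\<bar> = 1"
      using that signing_abs[OF f(1)] by blast
    then show ?thesis
      using anti[of u v] by linarith
  qed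
  \<comment> \<open>The arcs of sign 1, in either direction; antisymmetry selects exactly one arc
    for each edge.\<close>
  define \<sigma> where "\<sigma> = {(u, v). (u, v) \<in> D \<union> D\<inverse> \<and> f u v = 1}"
  have "edges \<sigma> = T"
  proof (intro equalityI subsetI)
    fix e
    assume "e \<in> edges \<sigma>"
    then obtain u v where "e = {u, v}" "(u, v) \<in> D \<union> D\<inverse>"
      by (auto simp: \<sigma>_def)
    then show "e \<in> T"
      unfolding assms(3)[symmetric] using mem_edges_iff[of u v D] by blast
  next
    fix e
    assume "e \<in> T"
    then obtain u v where "e = {u, v}" "(u, v) \<in> D"
      unfolding assms(3)[symmetric] by auto
    then have "(u, v) \<in> \<sigma> \<or> (v, u) \<in> \<sigma>"
      using abs[of u v] anti[of u v] by (auto simp: \<sigma>_def)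
    then show "e \<in> edges \<sigma>"
      unfolding \<open>e = {u, v}\<close> mem_edges_iff .
  qed
  have "is_orientation \<sigma> (edges \<sigma>)"
  proof (rule is_orientation_edges)
    show "(v, u) \<notin> \<sigma>" if "(u, v) \<in> \<sigma>" for u v
      using that anti[of u v] by (auto simp: \<sigma>_def)
  qed
  then have orient: "is_orientation \<sigma> T"
    by (simp only: \<open>edges \<sigma> = T\<close>)
  have bound: "2 * \<bar>\<Sum>e\<in>T'. agreement \<sigma> \<sigma>' e\<bar> \<le> int k + 4 * int l + 5"
    if T': "(T', \<sigma>') \<in> rooted_subtrees T" for T' \<sigma>'
  proof (cases "T' = {}")
    case False
    then obtain \<rho> j where A: "arborescence \<sigma>' \<rho> j" "edges \<sigma>' = T'"
      using rooted_subtree_arborescence[OF assms(1) T'] by blast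
    note out = arborescence_out_tree[OF A(1)]
    have "T' \<subseteq> T"
      using T' by (simp add: rooted_subtrees_def subtree_def)
    have sub: "\<sigma>' \<subseteq> D \<union> D\<inverse>"
    proof (rule subrelI)
      fix u v
      assume "(u, v) \<in> \<sigma>'"
      then have "{u, v} \<in> edges D"
        using \<open>T' \<subseteq> T\<close> unfolding A(2)[symmetric] assms(3)[symmetric] by blast
      then show "(u, v) \<in> D \<union> D\<inverse>"
        unfolding mem_edges_iff by blast
    qed
    have "f u v = (if (u, v) \<in> \<sigma> then 1 else -1)" if "(u, v) \<in> \<sigma>'" for u v
    proof -
      have "(u, v) \<in> D \<union> D\<inverse>"
        using that sub by blast
      then show ?thesis
        using abs[of u v] unfolding \<sigma>_def by auto
    qed
    then have "arc_sum (\<lambda>u v. if (u, v) \<in> \<sigma> then 1 else -1) \<sigma>' = arc_sum f \<sigma>'"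
      by (intro sum.cong) auto
    then have "(\<Sum>e\<in>T'. agreement \<sigma> \<sigma>' e) = arc_sum f \<sigma>'"
      unfolding A(2)[symmetric] using sum_agreement[of \<sigma>' \<sigma>] out_tree_asym[OF out] by simp
    \<comment> \<open>With \<open>h = 1\<close> the third bound leaves at most
      \<open>k + 4 * l + 3\<close> above and \<open>k + 4 * l + 4\<close> below in absolute value;
      the constant 5 covers both.\<close>
    moreover have "2 * p \<le> int k + 1" "2 * n \<le> int k"
      by (auto simp: p_def n_def)
    ultimately show ?thesis
      using bounded_sumsD(3)[OF f(2) out sub] by linarith
  qed simp
  let ?g = "\<lambda>\<sigma> (T', \<sigma>'). \<bar>\<Sum>e\<in>T'. agreement \<sigma> \<sigma>' e\<bar>"
  have "oriented_discrepancy T \<le> (MAX x\<in>rooted_subtrees T. ?g \<sigma> x)"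
    unfolding oriented_discrepancy_def
    using finite_orientations[OF assms(1)] orient by (intro Min_le) auto
  moreover have "(MAX x\<in>rooted_subtrees T. ?g \<sigma> x) \<in> ?g \<sigma> ` rooted_subtrees T"
    using finite_rooted_subtrees[OF assms(1)] rooted_subtrees_nonempty by (intro Max_in) auto
  ultimately show ?thesis
    using bound l(1) by (intro exI[of _ l]) fastforce
qed

section \<open>Asymptotics in the number of leaves\<close>

lemma oriented_discrepancy_empty: "oriented_discrepancy {} = 0"
proof -
  have "is_tree ({} :: 'a set set)"
    by (auto simp: is_tree_def edge_connected_def is_cycle_def is_path_def
        neq_Nil_conv Suc_le_length_iff numeral_3_eq_3)
  then have "{\<sigma> :: ('a \<times> 'a) set. is_orientation \<sigma> {}} \<noteq> {}"
    by (rule orientations_nonempty)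
  moreover have "(MAX (T', \<sigma>')\<in>rooted_subtrees ({} :: 'a set set). \<bar>\<Sum>e\<in>T'. agreement \<sigma> \<sigma>' e\<bar>) = 0"
    for \<sigma>
  proof -
    have "(\<lambda>(T', \<sigma>'). \<bar>\<Sum>e\<in>T'. agreement \<sigma> \<sigma>' e\<bar>) ` rooted_subtrees ({} :: 'a set set) = {0}"
      using rooted_subtrees_nonempty[of "{} :: 'a set set"]
      by (auto simp: rooted_subtrees_def subtree_def image_iff)
    then show ?thesis
      by simp
  qed
  ultimately show ?thesis
    by (auto simp: oriented_discrepancy_def image_constant_conv)
qed

text \<open>As \<open>m\<close> is \<open>k\<close> or \<open>k + 1\<close>, the lower bound loses
  at most 1/2, and \<open>2 ^ l \<le> k \<le> m\<close> turns the term \<open>4 * l\<close> into a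
  logarithm.\<close>

lemma oriented_discrepancy_near_half:
  assumes "is_tree T" "T \<noteq> {}"
  defines "m \<equiv> real (card (leaves T))"
  shows "m > 0" and "\<bar>real_of_int (oriented_discrepancy T) - m / 2\<bar> \<le> 5 / 2 + 2 * log 2 m"
proof -
  obtain e where "e \<in> T"
    using assms(2) by blast
  then have "card e = 2"
    using assms(1) by (simp add: is_tree_def)
  then obtain r where "r \<in> e"
    by (auto simp: card_2_iff)
  then have "r \<in> \<Union>T"
    using \<open>e \<in> T\<close> by (rule UnionI[rotated])
  then obtain D k where D: "arborescence D r k" "edges D = T"
    using tree_arborescence[OF assms(1)] by blast
  have m: "real k \<le> m" "m \<le> real k + 1"
    using leaves_bounds[OF D(1)] unfolding D(2) m_def by linarith+
  have k: "real k \<ge> 1"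
    using arborescence_pos[OF D(1)] by simp
  then show "m > 0"
    using m by linarith
  obtain l where l: "2 ^ l \<le> k" "2 * oriented_discrepancy T \<le> int k + 4 * int l + 5"
    using oriented_discrepancy_le[OF assms(1) D] by blast
  have "2 ^ l \<le> m"
    using l(1) m(1) by (metis of_nat_le_iff of_nat_numeral of_nat_power order_trans)
  then have "real l \<le> log 2 m"
    by (simp add: le_log_iff \<open>m > 0\<close> powr_realpow)
  have lower: "int k \<le> 2 * oriented_discrepancy T"
    using oriented_discrepancy_ge[OF assms(1) D] .
  have "2 * real_of_int (oriented_discrepancy T) \<le> real k + 4 * real l + 5"
    using l(2) by linarith
  moreover have "real k \<le> 2 * real_of_int (oriented_discrepancy T)"
    using lower by linarith
  ultimately show "\<bar>real_of_int (oriented_discrepancy T) - m / 2\<bar> \<le> 5 / 2 + 2 * log 2 m"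
    using m \<open>real l \<le> log 2 m\<close> by linarith
qed

theorem theorem1p4:
  shows "\<exists>\<delta> :: nat \<Rightarrow> real. \<delta> \<longlonglongrightarrow> 0 \<and>
    (\<forall>T :: 'a set set. is_tree T \<longrightarrow>
      (\<exists>\<eta>. \<bar>\<eta>\<bar> \<le> \<delta> (card (leaves T)) \<and>
        real_of_int (oriented_discrepancy T) = (1 / 2 + \<eta>) * real (card (leaves T))))"
proof (intro exI conjI allI impI)
  \<comment> \<open>The error in \<open>oriented_discrepancy_near_half\<close>, divided by the
    number of leaves; at \<open>m = 0\<close> division by zero makes it 0.\<close>
  let ?\<delta> = "\<lambda>m :: nat. (5 / 2 + 2 * log 2 (real m)) / real m"
  show "?\<delta> \<longlonglongrightarrow> 0"
  proof -
    have "(\<lambda>m. 5 / 2 * (1 / real m) + 2 / ln 2 * (ln (real m) / real m)) \<longlonglongrightarrow> 5 / 2 * 0 + 2 / ln 2 * 0"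
      by (intro tendsto_add tendsto_mult tendsto_const lim_1_over_n
          filterlim_compose[OF ln_x_over_x_tendsto_0 filterlim_real_sequentially])
    then show ?thesis
      by (simp add: log_def add_divide_distrib)
  qed
  fix T :: "'a set set"
  assume T: "is_tree T"
  let ?m = "real (card (leaves T))"
  \<comment> \<open>The single-vertex tree has no leaves in this encoding, so the equation reduces
    to its discrepancy being 0. For any other tree \<open>?m\<close> is positive and
    \<open>?\<eta>\<close> solves the equation.\<close>
  let ?\<eta> = "if T = {} then 0 else (real_of_int (oriented_discrepancy T) - ?m / 2) / ?m"
  show "\<bar>?\<eta>\<bar> \<le> ?\<delta> (card (leaves T))"
  proof (cases "T = {}")
    case True
    then show ?thesis
      by (simp add: leaves_def)
  next
    case False
    note near = oriented_discrepancy_near_half[OF T False]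
    have "\<bar>?\<eta>\<bar> = \<bar>real_of_int (oriented_discrepancy T) - ?m / 2\<bar> / ?m"
      using False near(1) by simp
    also have "\<dots> \<le> ?\<delta> (card (leaves T))"
      using near by (intro divide_right_mono) auto
    finally show ?thesis .
  qed
  show "real_of_int (oriented_discrepancy T) = (1 / 2 + ?\<eta>) * ?m"
  proof (cases "T = {}")
    case True
    then show ?thesis
      by (simp add: leaves_def oriented_discrepancy_empty)
  next
    case False
    then show ?thesis
      using oriented_discrepancy_near_half(1)[OF T False] by (simp add: field_simps)
  qed
qed

end
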